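(* For every integer $n\ge 1$ there exists a planar polynomial differential system $\dot x=P(x,y)$, $\dot y=Q(x,y)$ of degree $n$ (with $P,Q\in\mathbb{R}[x,y]$ and $\max(\deg P,\deg Q)=n$) having a center whose period annulus has a number of critical periods that is at least $$\frac{n^2}{2}+n-\frac52 \ \text{ if } n \text{ is odd},\qquad \frac{n^2}{2}-2\ \text{ if } n\text{ is even}.$$
   Context: The period annulus around a center is the maximal punctured neighbourhood of the center filled with periodic orbits. Parameterizing its periodic orbits by a real number $h$ (through a global smooth transversal section, or, for a Hamiltonian system, by the value $h$ of the Hamiltonian), the period function $T(h)$ assigns to each periodic orbit its minimal period. If the period function is not monotone (in particular, not constant), its local maxima and local minima are called critical periods; the number of critical periods is the number of such local extrema, and it does not depend on the choice of section or parametrization. *)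

theory Defs
  imports "HOL-Analysis.Analysis" "HOL-Computational_Algebra.Polynomial"
begin

text \<open>A polynomial in \<open>\<real>[x,y]\<close> is encoded as an element of \<open>\<real>[x][y]\<close>: the coefficient of
  \<open>x\<^sup>i y\<^sup>j\<close> in \<open>P\<close> is \<open>coeff (coeff P j) i\<close>.\<close>

definition eval2 :: "real poly poly \<Rightarrow> real \<Rightarrow> real \<Rightarrow> real" where
  "eval2 P x y = poly (poly P [:y:]) x"

text \<open>As for \<^const>\<open>degree\<close>, the zero polynomial gets degree \<open>0\<close>.\<close>

definition total_degree :: "real poly poly \<Rightarrow> nat" where
  "total_degree P = (if P = 0 then 0 else Max {i + j | i j. coeff (coeff P j) i \<noteq> 0})"

definition system_degree :: "real poly poly \<Rightarrow> real poly poly \<Rightarrow> nat" where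
  "system_degree P Q = max (total_degree P) (total_degree Q)"

definition vector_field ::
    "real poly poly \<Rightarrow> real poly poly \<Rightarrow> real \<times> real \<Rightarrow> real \<times> real" where
  "vector_field P Q = (\<lambda>(x, y). (eval2 P x y, eval2 Q x y))"

definition is_solution :: "(real \<times> real \<Rightarrow> real \<times> real) \<Rightarrow> (real \<Rightarrow> real \<times> real) \<Rightarrow> bool" where
  "is_solution X \<gamma> \<longleftrightarrow> (\<forall>t. (\<gamma> has_vector_derivative X (\<gamma> t)) (at t))"

text \<open>Equilibria do not count as periodic orbits.\<close>

definition periodic_orbits :: "(real \<times> real \<Rightarrow> real \<times> real) \<Rightarrow> (real \<times> real) set set" where
  "periodic_orbits X = {range \<gamma> | \<gamma>.
     is_solution X \<gamma> \<and> \<not> \<gamma> constant_on UNIV \<and> (\<exists>T>0. \<forall>t. \<gamma> (t + T) = \<gamma> t)}"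

text \<open>The minimal period of the periodic orbit through \<open>q\<close>; it is used only for points \<open>q\<close> that lie on
  a periodic orbit of a polynomial (hence locally Lipschitz) vector field, where the solution
  through \<open>q\<close> is unique and the least positive period exists.\<close>

definition minimal_period :: "(real \<times> real \<Rightarrow> real \<times> real) \<Rightarrow> real \<times> real \<Rightarrow> real" where
  "minimal_period X q =
     (LEAST T. 0 < T \<and> (\<exists>\<gamma>. is_solution X \<gamma> \<and> \<gamma> 0 = q \<and> (\<forall>t. \<gamma> (t + T) = \<gamma> t)))"

definition is_center :: "(real \<times> real \<Rightarrow> real \<times> real) \<Rightarrow> real \<times> real \<Rightarrow> bool" where
  "is_center X p \<longleftrightarrow> X p = 0 \<and>
     (\<exists>V. open V \<and> p \<in> V \<and> V - {p} \<subseteq> \<Union>(periodic_orbits X))"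

text \<open>Open connected neighbourhoods of \<open>p\<close> are closed under arbitrary unions, so the union below is
  the largest one that, punctured at \<open>p\<close>, is filled with periodic orbits. Without connectedness it
  would also contain unrelated period annuli elsewhere in the plane.\<close>

definition period_annulus ::
    "(real \<times> real \<Rightarrow> real \<times> real) \<Rightarrow> real \<times> real \<Rightarrow> (real \<times> real) set" where
  "period_annulus X p =
     \<Union>{V. open V \<and> connected V \<and> p \<in> V \<and> V - {p} \<subseteq> \<Union>(periodic_orbits X)} - {p}"

text \<open>\<open>C\<^sup>\<infinity>\<close> on the open set \<open>I\<close>; \<open>D k\<close> is the \<open>k\<close>-th derivative of \<open>\<sigma>\<close>.\<close>

definition smooth_curve_on :: "real set \<Rightarrow> (real \<Rightarrow> real \<times> real) \<Rightarrow> bool" where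
  "smooth_curve_on I \<sigma> \<longleftrightarrow>
     (\<exists>D :: nat \<Rightarrow> real \<Rightarrow> real \<times> real. D 0 = \<sigma> \<and>
        (\<forall>k. \<forall>h\<in>I. (D k has_vector_derivative D (Suc k) h) (at h)))"

definition transversal_on ::
    "(real \<times> real \<Rightarrow> real \<times> real) \<Rightarrow> real set \<Rightarrow> (real \<Rightarrow> real \<times> real) \<Rightarrow> bool" where
  "transversal_on X I \<sigma> \<longleftrightarrow>
     (\<forall>h\<in>I. let v = vector_derivative \<sigma> (at h); w = X (\<sigma> h)
            in fst v * snd w - snd v * fst w \<noteq> 0)"

text \<open>A smooth curve, parametrized by an open interval \<open>I\<close> (possibly unbounded), that lies in the
  set \<open>A\<close>, is transversal to \<open>X\<close> and meets each periodic orbit in \<open>A\<close> for exactly one parameter.\<close>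

definition global_transversal_section ::
    "(real \<times> real \<Rightarrow> real \<times> real) \<Rightarrow> (real \<times> real) set \<Rightarrow> real set \<Rightarrow> (real \<Rightarrow> real \<times> real) \<Rightarrow> bool"
  where
  "global_transversal_section X A I \<sigma> \<longleftrightarrow>
     open I \<and> is_interval I \<and> I \<noteq> {} \<and>
     smooth_curve_on I \<sigma> \<and> transversal_on X I \<sigma> \<and> \<sigma> ` I \<subseteq> A \<and>
     (\<forall>C\<in>periodic_orbits X. C \<subseteq> A \<longrightarrow> (\<exists>!h. h \<in> I \<and> \<sigma> h \<in> C))"

definition period_function ::
    "(real \<times> real \<Rightarrow> real \<times> real) \<Rightarrow> (real \<Rightarrow> real \<times> real) \<Rightarrow> real \<Rightarrow> real" where
  "period_function X \<sigma> h = minimal_period X (\<sigma> h)"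

text \<open>A monotone period function has no critical periods by convention; this matters for constant
  ones (isochronous centers), where every parameter is a (non-strict) local extremum.\<close>

definition critical_parameters :: "(real \<Rightarrow> real) \<Rightarrow> real set \<Rightarrow> real set" where
  "critical_parameters T I =
     (if mono_on I T \<or> antimono_on I T then {}
      else {h \<in> I. (\<forall>\<^sub>F h' in at h within I. T h' \<le> T h) \<or>
                   (\<forall>\<^sub>F h' in at h within I. T h \<le> T h')})"

definition num_critical_periods ::
    "(real \<times> real \<Rightarrow> real \<times> real) \<Rightarrow> real set \<Rightarrow> (real \<Rightarrow> real \<times> real) \<Rightarrow> enat" where
  "num_critical_periods X I \<sigma> =
     (let S = critical_parameters (period_function X \<sigma>) I
      in if finite S then enat (card S) else \<infinity>)"

end

theory Submission
  imports Defs "HOL-Library.Periodic_Fun"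
begin

text \<open>Take a system \<open>x' = -G'(y)\<close>, \<open>y' = F'(x)\<close>, whose energy \<open>F(x) + G(y)\<close> is conserved. If the polynomials \<open>F'\<close>
  and \<open>G'\<close> vanish only at \<open>0\<close>, and \<open>F\<close> and \<open>G\<close> have a nondegenerate minimum there, the levels of the energy
  are ovals around a center. An oval that passes close to a point where \<open>F'\<close> and \<open>G'\<close> are \<^emph>\<open>both\<close>
  nearly zero has a long period, because the motion is slow there. One polynomial of degree \<open>2m + 1\<close>
  has room for a simple zero and \<open>m\<close> nearly double zeros, so a pair of them produces a grid of
  \<open>(m + 1)\<^sup>2 - 1\<close> slow points besides the center.

  Concretely, let \<open>F'(x) = x w(x) (\<Prod>\<^sub>i (x - i)\<^sup>2 + \<epsilon>)\<close> and \<open>G'(y) = \<kappa> y (\<Prod>\<^sub>j (y - j)\<^sup>2 + \<epsilon>)\<close>, where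
  \<open>i\<close> and \<open>j\<close> range over \<open>1, \<dots>, m\<close>. As \<open>\<epsilon>\<close> tends to \<open>0\<close> from above:

  \<^item> the period of the oval through a grid point \<open>(i, j) \<noteq> (0, 0)\<close>, \<open>0 \<le> i, j \<le> m\<close>, tends to
    infinity (\<open>period_unbounded_at_tooth\<close>). The field has size \<open>O(\<epsilon>)\<close> at that point, so by Gronwall's
    inequality it takes a time of order \<open>log (1/\<epsilon>)\<close> to move away from it by a distance \<open>1\<close>;

  \<^item> the period of the oval of a fixed energy that is not the energy of a grid point for \<open>\<epsilon> = 0\<close>
    stays bounded (\<open>period_bounded_at_regular_energy\<close>). By compactness the speed on these ovals is
    bounded away from \<open>0\<close>, and their length is bounded.

  For all but finitely many \<open>\<kappa>\<close> the energies of the grid points are distinct. With one regular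
  energy below all of them, one between any two neighbours and one above all of them, one sees the
  period function alternate between low and high values, which forces \<open>k = (m + 1)\<^sup>2 - 1\<close> local maxima and \<open>k - 1\<close> local minima between
  them. With \<open>w = 1\<close> the degree is \<open>n = 2m + 1\<close> and \<open>2k - 1 = n\<^sup>2/2 + n - 5/2\<close>. For the even degree
  \<open>n = 2m + 2\<close> take \<open>w(x) = m + 2 - x\<close>. The annulus is then bounded by the level of the new equilibrium
  \<open>(m + 2, 0)\<close>, where the period tends to infinity (\<open>period_unbounded_at_saddle\<close>). This yields one
  further minimum, and \<open>2k = n\<^sup>2/2 - 2\<close>.

  To get hold of the period function, write \<open>F = u\<^sup>2\<close> and \<open>G = v\<^sup>2\<close> with increasing diffeomorphisms \<open>u\<close>
  and \<open>v\<close> with inverses \<open>\<phi>\<close> and \<open>\<psi>\<close>. The ovals become circles, and the oval through \<open>(h, 0)\<close> has the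
  period \<open>\<integral> \<phi>'(r cos s) \<psi>'(r sin s) / 2 ds\<close> over \<open>0 \<le> s \<le> 2\<pi>\<close>, where \<open>r = u(h)\<close>. This shows that the
  ovals are periodic orbits and that the period depends continuously on \<open>h\<close>.\<close>

section \<open>Tools from calculus\<close>

text \<open>A continuous injective function on an open set of reals is an open map; hence the inverse is
  continuous, and differentiable with the reciprocal derivative.\<close>

lemma derivative_of_inverse:
  fixes u u' :: "real \<Rightarrow> real"
  assumes S: "open S" "is_interval S"
    and der: "\<And>x. x \<in> S \<Longrightarrow> (u has_real_derivative u' x) (at x)"
    and pos: "\<And>x. x \<in> S \<Longrightarrow> 0 < u' x"
  shows "strict_mono_on S u" and "open (u ` S)" and "is_interval (u ` S)"
    and "continuous_on (u ` S) (inv_into S u)"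
    and "\<And>y. y \<in> u ` S \<Longrightarrow>
           (inv_into S u has_real_derivative inverse (u' (inv_into S u y))) (at y)"
proof -
  have cont: "continuous_on S u"
    by (rule DERIV_continuous_on[where D = u']) (rule has_field_derivative_at_within[OF der])
  show mono: "strict_mono_on S u"
  proof (rule strict_mono_onI)
    fix a b assume ab: "a \<in> S" "b \<in> S" "a < b"
    then have "{a..b} \<subseteq> S"
      using S(2) by (meson atLeastAtMost_iff is_interval_1 subsetI)
    then show "u a < u b"
      using DERIV_pos_imp_increasing[OF ab(3), of u] der pos by (meson atLeastAtMost_iff subsetD)
  qed
  then have inj: "inj_on u S"
    by (rule strict_mono_on_imp_inj_on)
  show op: "open (u ` S)"
    using injective_into_1d_imp_open_map_UNIV[OF S(1) cont inj] by simp
  show "is_interval (u ` S)"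
    using S(2) cont by (metis connected_continuous_image is_interval_connected_1)
  show ci: "continuous_on (u ` S) (inv_into S u)"
    using continuous_on_inverse_open[OF S(1) cont] inj by (simp add: inv_into_f_f)
  fix y assume y: "y \<in> u ` S"
  then obtain e where e: "e > 0" "ball y e \<subseteq> u ` S"
    using op openE by blast
  show "(inv_into S u has_real_derivative inverse (u' (inv_into S u y))) (at y)"
  proof (rule DERIV_inverse_function[where f = u and a = "y - e" and b = "y + e"])
    have i: "inv_into S u y \<in> S" using y by (rule inv_into_into)
    show "(u has_real_derivative u' (inv_into S u y)) (at (inv_into S u y))" using der i by simp
    show "u' (inv_into S u y) \<noteq> 0" using pos[OF i] by simp
    show "u (inv_into S u z) = z" if "y - e < z" "z < y + e" for z
    proof -
      have "z \<in> ball y e" using that by (auto simp: dist_real_def)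
      then show ?thesis using e by (meson f_inv_into_f subsetD)
    qed
    show "isCont (inv_into S u) y"
      using ci op y continuous_on_eq_continuous_at by blast
  qed (use e in auto)
qed

lemma antiderivative_on_line:
  fixes w :: "real \<Rightarrow> real"
  assumes "continuous_on UNIV w"
  obtains \<tau> where "\<And>s. (\<tau> has_real_derivative w s) (at s)" and "\<tau> 0 = 0"
proof -
  have "\<exists>F. \<forall>x. -\<infinity> < ereal x \<longrightarrow> ereal x < \<infinity> \<longrightarrow> (F has_vector_derivative w x) (at x)"
    using assms by (intro einterval_antiderivative)
      (auto simp: continuous_on_eq_continuous_at)
  then obtain F where F: "\<And>x. (F has_real_derivative w x) (at x)"
    by (auto simp: has_real_derivative_iff_has_vector_derivative)
  show ?thesis
    by (rule that[of "\<lambda>s. F s - F 0"]) (auto intro!: derivative_eq_intros F)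
qed

text \<open>For a closed curve with parameter \<open>s\<close> of period \<open>c\<close> that is traversed so that \<open>dt = w(s) ds\<close>,
  \<open>\<tau> s\<close> is the time at which the parameter value \<open>s\<close> is reached, and \<open>\<Theta> t\<close> is the parameter value at
  time \<open>t\<close>. One turn takes the time \<open>\<tau> c\<close>.\<close>

lemma periodic_clock:
  fixes w :: "real \<Rightarrow> real"
  assumes cont: "continuous_on UNIV w" and pos: "\<And>s. 0 < w s"
    and per: "\<And>s. w (s + c) = w s" and c: "0 < c"
  obtains \<tau> \<Theta> where
    "\<And>s. (\<tau> has_real_derivative w s) (at s)" "\<tau> 0 = 0" "\<tau> c = integral {0..c} w" "0 < \<tau> c"
    "\<And>t. (\<Theta> has_real_derivative inverse (w (\<Theta> t))) (at t)"
    "\<And>t. \<tau> (\<Theta> t) = t" "\<And>s. \<Theta> (\<tau> s) = s" "\<And>s. \<tau> (s + c) = \<tau> s + \<tau> c" "strict_mono \<tau>"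
proof -
  obtain \<tau> where \<tau>: "\<And>s. (\<tau> has_real_derivative w s) (at s)" and \<tau>0: "\<tau> 0 = 0"
    using antiderivative_on_line[OF cont] by blast
  have mono: "strict_mono \<tau>"
    using derivative_of_inverse(1)[of UNIV \<tau> w] \<tau> pos by (simp add: strict_mono_on_def strict_mono_def)
  have shift: "\<tau> (s + c) = \<tau> s + \<tau> c" for s
  proof -
    have "((\<lambda>s. \<tau> (s + c) - \<tau> s) has_real_derivative 0) (at s)" for s
    proof -
      have "((\<lambda>s. \<tau> (s + c)) has_real_derivative w (s + c)) (at s)"
        using \<tau>[of "s + c"] DERIV_shift by blast
      from DERIV_diff[OF this \<tau>[of s]] show ?thesis using per by simp
    qed
    then have "\<tau> (s + c) - \<tau> s = \<tau> (0 + c) - \<tau> 0"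
      using DERIV_isconst_all[of "\<lambda>s. \<tau> (s + c) - \<tau> s" s 0] by blast
    then show ?thesis using \<tau>0 by simp
  qed
  have tc: "0 < \<tau> c"
    using mono \<tau>0 c by (metis strict_monoD)
  have mult: "\<tau> (real n * c) = real n * \<tau> c \<and> \<tau> (- (real n * c)) = - (real n * \<tau> c)" for n
  proof (induction n)
    case 0 then show ?case using \<tau>0 by simp
  next
    case (Suc n)
    have "\<tau> (- (real n * c)) = \<tau> (- (real (Suc n) * c)) + \<tau> c"
      using shift[of "- (real (Suc n) * c)"] by (simp add: algebra_simps)
    then show ?case using Suc shift[of "real n * c"] by (simp add: algebra_simps)
  qed
  have ct: "continuous_on A \<tau>" for A
    by (rule DERIV_continuous_on[where D = w]) (rule has_field_derivative_at_within[OF \<tau>])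
  have surj: "\<exists>s. \<tau> s = t" for t
  proof -
    \<comment> \<open>\<open>\<tau>\<close> takes the values \<open>\<plusminus>n \<tau>(c)\<close>, hence it is unbounded in both directions.\<close>
    obtain n :: nat where n: "\<bar>t\<bar> < real n * \<tau> c"
      using tc reals_Archimedean3 by blast
    have "\<exists>s \<ge> - (real n * c). s \<le> real n * c \<and> \<tau> s = t"
      using n mult[of n] c by (intro IVT') (auto simp: ct)
    then show ?thesis by blast
  qed
  define \<Theta> where "\<Theta> = inv_into UNIV \<tau>"
  have im: "\<tau> ` UNIV = UNIV" using surj by (metis UNIV_eq_I rangeI)
  have inj: "inj \<tau>" using mono by (rule strict_mono_imp_inj_on)
  show ?thesis
  proof (rule that[of \<tau> \<Theta>])
    show "(\<Theta> has_real_derivative inverse (w (\<Theta> t))) (at t)" for t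
      unfolding \<Theta>_def using derivative_of_inverse(5)[of UNIV \<tau> w] \<tau> pos im by auto
    show "\<tau> (\<Theta> t) = t" for t unfolding \<Theta>_def using im by (metis UNIV_I f_inv_into_f)
    show "\<Theta> (\<tau> s) = s" for s unfolding \<Theta>_def using inj by simp
    have "(w has_integral (\<tau> c - \<tau> 0)) {0..c}"
      using c \<tau> by (intro fundamental_theorem_of_calculus)
        (auto simp: has_real_derivative_iff_has_vector_derivative intro: has_vector_derivative_at_within)
    then show "\<tau> c = integral {0..c} w" using \<tau>0 by (simp add: integral_unique)
  qed (use \<tau> \<tau>0 mono shift tc in auto)
qed

text \<open>The function \<open>(z + B / A) exp (- A t)\<close> does not increase.\<close>

lemma gronwall:
  fixes z z' :: "real \<Rightarrow> real"
  assumes der: "\<And>s. 0 \<le> s \<Longrightarrow> s \<le> t \<Longrightarrow> (z has_real_derivative z' s) (at s)"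
    and le: "\<And>s. 0 \<le> s \<Longrightarrow> s \<le> t \<Longrightarrow> z' s \<le> A * z s + B"
    and A: "0 < A" and t: "0 \<le> t"
  shows "z t \<le> (z 0 + B / A) * exp (A * t) - B / A"
proof -
  let ?e = "\<lambda>t. - ((z t + B / A) * exp (- (A * t)))"
  have "?e 0 \<le> ?e t"
  proof (rule DERIV_nonneg_imp_nondecreasing[OF t])
    fix s assume s: "0 \<le> s" "s \<le> t"
    have "(?e has_real_derivative - (z' s - A * z s - B) * exp (- (A * s))) (at s)"
      using A by (auto intro!: derivative_eq_intros der s simp: field_simps)
    moreover have "0 \<le> - (z' s - A * z s - B) * exp (- (A * s))"
      using le[OF s] by (intro mult_nonneg_nonneg) auto
    ultimately show "\<exists>y. (?e has_real_derivative y) (at s) \<and> 0 \<le> y" by blast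
  qed
  then have "(z t + B / A) * exp (- (A * t)) * exp (A * t) \<le> (z 0 + B / A) * exp (A * t)"
    by (intro mult_right_mono) auto
  then show ?thesis by (simp add: mult.assoc exp_minus)
qed

lemma poly_lipschitz_on_bounded:
  fixes p :: "real poly"
  obtains L where "0 \<le> L" "\<And>x y. \<bar>x\<bar> \<le> R \<Longrightarrow> \<bar>y\<bar> \<le> R \<Longrightarrow> \<bar>poly p x - poly p y\<bar> \<le> L * \<bar>x - y\<bar>"
proof -
  have "compact (poly (pderiv p) ` {-R..R})"
    by (intro compact_continuous_image continuous_intros) auto
  then obtain B where B: "\<And>x. x \<in> {-R..R} \<Longrightarrow> \<bar>poly (pderiv p) x\<bar> \<le> B"
    by (metis (no_types, opaque_lifting) compact_imp_bounded bounded_iff image_eqI real_norm_def)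
  show ?thesis
  proof (rule that[of "\<bar>B\<bar>"])
    fix x y :: real assume xy: "\<bar>x\<bar> \<le> R" "\<bar>y\<bar> \<le> R"
    have "norm (poly p x - poly p y) \<le> \<bar>B\<bar> * norm (x - y)"
    proof (rule field_differentiable_bound[where S = "{-R..R}" and f' = "poly (pderiv p)"])
      show "norm (poly (pderiv p) z) \<le> \<bar>B\<bar>" if "z \<in> {-R..R}" for z
        using B[OF that] by auto
    qed (use xy in \<open>auto intro: poly_DERIV DERIV_subset\<close>)
    then show "\<bar>poly p x - poly p y\<bar> \<le> \<bar>B\<bar> * \<bar>x - y\<bar>" by simp
  qed auto
qed

lemma lipschitz_linear_family:
  fixes a b :: "real poly"
  obtains \<Lambda> where "0 \<le> \<Lambda>" "\<And>\<epsilon> x y. 0 \<le> \<epsilon> \<Longrightarrow> \<epsilon> \<le> 1 \<Longrightarrow> \<bar>x\<bar> \<le> R \<Longrightarrow> \<bar>y\<bar> \<le> R \<Longrightarrow>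
      \<bar>poly (a + smult \<epsilon> b) x - poly (a + smult \<epsilon> b) y\<bar> \<le> \<Lambda> * \<bar>x - y\<bar>"
proof -
  obtain A where A: "0 \<le> A" "\<And>x y. \<bar>x\<bar> \<le> R \<Longrightarrow> \<bar>y\<bar> \<le> R \<Longrightarrow> \<bar>poly a x - poly a y\<bar> \<le> A * \<bar>x - y\<bar>"
    using poly_lipschitz_on_bounded by blast
  obtain B where B: "0 \<le> B" "\<And>x y. \<bar>x\<bar> \<le> R \<Longrightarrow> \<bar>y\<bar> \<le> R \<Longrightarrow> \<bar>poly b x - poly b y\<bar> \<le> B * \<bar>x - y\<bar>"
    using poly_lipschitz_on_bounded by blast
  show ?thesis
  proof (rule that[of "A + B"])
    fix \<epsilon> x y :: real assume \<epsilon>: "0 \<le> \<epsilon>" "\<epsilon> \<le> 1" and xy: "\<bar>x\<bar> \<le> R" "\<bar>y\<bar> \<le> R"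
    have "poly (a + smult \<epsilon> b) x - poly (a + smult \<epsilon> b) y =
        (poly a x - poly a y) + \<epsilon> * (poly b x - poly b y)" by (simp add: algebra_simps)
    also have "\<bar>\<dots>\<bar> \<le> \<bar>poly a x - poly a y\<bar> + \<bar>\<epsilon>\<bar> * \<bar>poly b x - poly b y\<bar>"
      by (metis abs_mult abs_triangle_ineq)
    also have "\<dots> \<le> A * \<bar>x - y\<bar> + 1 * (B * \<bar>x - y\<bar>)"
      using \<epsilon> A(2)[OF xy] B(2)[OF xy] by (intro add_mono mult_mono) auto
    finally show "\<bar>poly (a + smult \<epsilon> b) x - poly (a + smult \<epsilon> b) y\<bar> \<le> (A + B) * \<bar>x - y\<bar>"
      by (simp add: algebra_simps)
  qed (use A(1) B(1) in simp)
qed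

lemma periodic_representative:
  fixes \<gamma> :: "real \<Rightarrow> 'a"
  assumes "0 < T" "\<And>t. \<gamma> (t + T) = \<gamma> t"
  obtains s where "0 \<le> s" "s \<le> T" "\<gamma> s = \<gamma> t"
proof -
  interpret periodic_fun_simple \<gamma> T by unfold_locales (rule assms(2))
  define n where "n = \<lfloor>t / T\<rfloor>"
  have "of_int n \<le> t / T" "t / T < of_int n + 1" unfolding n_def by linarith+
  then have "of_int n * T \<le> t" "t < (of_int n + 1) * T"
    using assms(1) by (simp_all add: pos_le_divide_eq pos_divide_less_eq)
  moreover have "\<gamma> (t - of_int n * T) = \<gamma> t" by (rule minus_of_int)
  ultimately show ?thesis by (intro that[of "t - of_int n * T"]) (auto simp: algebra_simps)
qed

section \<open>Solutions of separable systems\<close>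

text \<open>With time reversed, this is the Hamiltonian field of \<open>F(x) + G(y)\<close>, where \<open>F' = f\<close> and \<open>G' = g\<close>. Its
  orbits turn counterclockwise around a minimum of the energy.\<close>

definition separable_field :: "real poly \<Rightarrow> real poly \<Rightarrow> real \<times> real \<Rightarrow> real \<times> real" where
  "separable_field f g = (\<lambda>(x, y). (- poly g y, poly f x))"

lemma is_solution_separable_iff:
  "is_solution (separable_field f g) \<gamma> \<longleftrightarrow>
    (\<forall>t. ((\<lambda>t. fst (\<gamma> t)) has_real_derivative - poly g (snd (\<gamma> t))) (at t) \<and>
         ((\<lambda>t. snd (\<gamma> t)) has_real_derivative poly f (fst (\<gamma> t))) (at t))"
    (is "?l \<longleftrightarrow> ?r")
proof
  assume l: ?l
  show ?r
  proof
    fix t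
    have "(\<gamma> has_vector_derivative separable_field f g (\<gamma> t)) (at t)"
      using l by (simp add: is_solution_def)
    from bounded_linear.has_vector_derivative[OF bounded_linear_fst this]
      bounded_linear.has_vector_derivative[OF bounded_linear_snd this]
    show "((\<lambda>t. fst (\<gamma> t)) has_real_derivative - poly g (snd (\<gamma> t))) (at t) \<and>
         ((\<lambda>t. snd (\<gamma> t)) has_real_derivative poly f (fst (\<gamma> t))) (at t)"
      by (simp add: has_real_derivative_iff_has_vector_derivative separable_field_def split_beta)
  qed
next
  assume r: ?r
  show ?l unfolding is_solution_def
  proof
    fix t
    have "((\<lambda>t. (fst (\<gamma> t), snd (\<gamma> t))) has_vector_derivative
        (- poly g (snd (\<gamma> t)), poly f (fst (\<gamma> t)))) (at t)"
      using r by (intro has_vector_derivative_Pair)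
        (simp_all add: has_real_derivative_iff_has_vector_derivative)
    then show "(\<gamma> has_vector_derivative separable_field f g (\<gamma> t)) (at t)"
      by (simp add: separable_field_def split_beta)
  qed
qed

lemma solution_shift:
  assumes "is_solution (separable_field f g) \<gamma>"
  shows "is_solution (separable_field f g) (\<lambda>t. \<gamma> (t + s))"
  using assms DERIV_shift[of "\<lambda>t. fst (\<gamma> t)" _ _ s] DERIV_shift[of "\<lambda>t. snd (\<gamma> t)" _ _ s]
  unfolding is_solution_separable_iff by blast

lemma solution_components:
  assumes "is_solution (separable_field f g) \<gamma>"
  shows "((\<lambda>t. fst (\<gamma> t)) has_real_derivative - poly g (snd (\<gamma> t))) (at t)"
    and "((\<lambda>t. snd (\<gamma> t)) has_real_derivative poly f (fst (\<gamma> t))) (at t)"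
  using assms by (auto simp: is_solution_separable_iff)

lemma solution_continuous:
  assumes "is_solution (separable_field f g) \<gamma>"
  shows "continuous_on A (\<lambda>t. fst (\<gamma> t))" "continuous_on A (\<lambda>t. snd (\<gamma> t))"
  by (rule DERIV_continuous_on, rule has_field_derivative_at_within, rule solution_components[OF assms])+

lemma mult_le_abs_mult:
  fixes u v c :: real
  assumes "\<bar>v\<bar> \<le> c"
  shows "u * v \<le> \<bar>u\<bar> * c"
proof -
  have "u * v \<le> \<bar>u\<bar> * \<bar>v\<bar>" by (metis abs_ge_self abs_mult)
  also have "\<dots> \<le> \<bar>u\<bar> * c" using assms by (intro mult_left_mono) auto
  finally show ?thesis .
qed

text \<open>A Lipschitz constant on a box that contains both arcs gives \<open>z' \<le> A z\<close> for the squared distance \<open>z\<close>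
  of the two solutions, and \<open>z(0) = 0\<close>.\<close>

lemma solution_unique:
  assumes sol: "is_solution (separable_field f g) \<gamma>" "is_solution (separable_field f g) \<delta>"
    and init: "\<gamma> 0 = \<delta> 0" and t: "0 \<le> t"
  shows "\<gamma> t = \<delta> t"
proof -
  have bdd: "\<exists>R. \<forall>s\<in>{0..t}. \<bar>h s\<bar> \<le> R" if "continuous_on {0..t} h" for h :: "real \<Rightarrow> real"
    using compact_imp_bounded[OF compact_continuous_image[OF that compact_Icc]]
    by (auto simp: bounded_iff)
  obtain a b c d where abcd: "\<forall>s\<in>{0..t}. \<bar>fst (\<gamma> s)\<bar> \<le> a" "\<forall>s\<in>{0..t}. \<bar>snd (\<gamma> s)\<bar> \<le> b"
      "\<forall>s\<in>{0..t}. \<bar>fst (\<delta> s)\<bar> \<le> c" "\<forall>s\<in>{0..t}. \<bar>snd (\<delta> s)\<bar> \<le> d"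
    using bdd[OF solution_continuous(1)[OF sol(1)]] bdd[OF solution_continuous(2)[OF sol(1)]]
      bdd[OF solution_continuous(1)[OF sol(2)]] bdd[OF solution_continuous(2)[OF sol(2)]] by metis
  define R where "R = max (max a b) (max c d)"
  have inR: "\<bar>fst (\<gamma> s)\<bar> \<le> R" "\<bar>snd (\<gamma> s)\<bar> \<le> R" "\<bar>fst (\<delta> s)\<bar> \<le> R" "\<bar>snd (\<delta> s)\<bar> \<le> R"
    if "0 \<le> s" "s \<le> t" for s
    using abcd that unfolding R_def by (simp_all add: le_max_iff_disj)
  obtain L1 where L1: "0 \<le> L1" "\<And>x y. \<bar>x\<bar> \<le> R \<Longrightarrow> \<bar>y\<bar> \<le> R \<Longrightarrow> \<bar>poly f x - poly f y\<bar> \<le> L1 * \<bar>x - y\<bar>"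
    using poly_lipschitz_on_bounded by blast
  obtain L2 where L2: "0 \<le> L2" "\<And>x y. \<bar>x\<bar> \<le> R \<Longrightarrow> \<bar>y\<bar> \<le> R \<Longrightarrow> \<bar>poly g x - poly g y\<bar> \<le> L2 * \<bar>x - y\<bar>"
    using poly_lipschitz_on_bounded by blast
  define X where "X s = fst (\<gamma> s) - fst (\<delta> s)" for s
  define Y where "Y s = snd (\<gamma> s) - snd (\<delta> s)" for s
  define z where "z s = (X s)\<^sup>2 + (Y s)\<^sup>2" for s
  define z' where "z' s = 2 * X s * (poly g (snd (\<delta> s)) - poly g (snd (\<gamma> s))) +
                          2 * Y s * (poly f (fst (\<gamma> s)) - poly f (fst (\<delta> s)))" for s
  have "z t \<le> (z 0 + 0 / (L1 + L2 + 1)) * exp ((L1 + L2 + 1) * t) - 0 / (L1 + L2 + 1)"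
  proof (rule gronwall[where z' = z'])
    fix s assume s: "0 \<le> s" "s \<le> t"
    show "(z has_real_derivative z' s) (at s)"
      unfolding z_def z'_def X_def Y_def
      by (auto intro!: derivative_eq_intros solution_components sol simp: algebra_simps)
    have 1: "\<bar>poly g (snd (\<delta> s)) - poly g (snd (\<gamma> s))\<bar> \<le> L2 * \<bar>Y s\<bar>"
      unfolding Y_def abs_minus_commute[of "snd (\<gamma> s)"] by (intro L2(2) inR s)
    have 2: "\<bar>poly f (fst (\<gamma> s)) - poly f (fst (\<delta> s))\<bar> \<le> L1 * \<bar>X s\<bar>"
      unfolding X_def by (intro L1(2) inR s)
    have am: "2 * (\<bar>X s\<bar> * \<bar>Y s\<bar>) \<le> z s"
      unfolding z_def using sum_squares_bound[of "\<bar>X s\<bar>" "\<bar>Y s\<bar>"] by simp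
    have "X s * (poly g (snd (\<delta> s)) - poly g (snd (\<gamma> s))) \<le> \<bar>X s\<bar> * (L2 * \<bar>Y s\<bar>)"
      using 1 2 by (auto intro!: mult_le_abs_mult simp: abs_minus_commute)
    moreover have "Y s * (poly f (fst (\<gamma> s)) - poly f (fst (\<delta> s))) \<le> \<bar>Y s\<bar> * (L1 * \<bar>X s\<bar>)"
      using 1 2 by (auto intro!: mult_le_abs_mult simp: abs_minus_commute)
    ultimately have "z' s \<le> (L1 + L2) * (2 * (\<bar>X s\<bar> * \<bar>Y s\<bar>))"
      unfolding z'_def by (simp add: algebra_simps)
    also have "\<dots> \<le> (L1 + L2) * z s"
      using am L1(1) L2(1) by (intro mult_left_mono) auto
    also have "\<dots> \<le> (L1 + L2 + 1) * z s + 0"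
      by (simp add: z_def algebra_simps)
    finally show "z' s \<le> (L1 + L2 + 1) * z s + 0" .
  qed (use L1(1) L2(1) t in auto)
  then have "z t \<le> 0" using init by (simp add: z_def X_def Y_def)
  then have "X t = 0 \<and> Y t = 0"
    unfolding z_def by (metis sum_power2_le_zero_iff)
  then show ?thesis by (simp add: X_def Y_def prod_eq_iff)
qed

text \<open>If \<open>\<eta>\<close> is the speed at the initial point, the squared distance \<open>z\<close> from it satisfies
  \<open>z' \<le> (2\<Lambda> + 1) z + \<eta>\<^sup>2\<close> with a Lipschitz constant \<open>\<Lambda>\<close>. So a solution that starts where the field is
  nearly zero needs a time of order \<open>log (1/\<eta>)\<close> to get away from there. The same constant serves for a
  whole family of fields with a common Lipschitz bound.\<close>

lemma slow_escape:
  assumes sol: "is_solution (separable_field f g) \<gamma>" and init: "\<gamma> 0 = (a, b)" and t: "0 \<le> t"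
    and box: "\<And>s. \<bar>fst (\<gamma> s)\<bar> \<le> R" "\<And>s. \<bar>snd (\<gamma> s)\<bar> \<le> R"
    and lip_f: "\<And>x y. \<bar>x\<bar> \<le> R \<Longrightarrow> \<bar>y\<bar> \<le> R \<Longrightarrow> \<bar>poly f x - poly f y\<bar> \<le> L * \<bar>x - y\<bar>"
    and lip_g: "\<And>x y. \<bar>x\<bar> \<le> R \<Longrightarrow> \<bar>y\<bar> \<le> R \<Longrightarrow> \<bar>poly g x - poly g y\<bar> \<le> L * \<bar>x - y\<bar>"
    and L: "0 \<le> L"
  shows "(fst (\<gamma> t) - a)\<^sup>2 + (snd (\<gamma> t) - b)\<^sup>2
          \<le> ((poly f a)\<^sup>2 + (poly g b)\<^sup>2) * exp ((2 * L + 1) * t)"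
proof -
  define X where "X s = fst (\<gamma> s) - a" for s
  define Y where "Y s = snd (\<gamma> s) - b" for s
  define z where "z s = (X s)\<^sup>2 + (Y s)\<^sup>2" for s
  define z' where "z' s = 2 * X s * (- poly g (snd (\<gamma> s))) + 2 * Y s * poly f (fst (\<gamma> s))" for s
  define B where "B = (poly f a)\<^sup>2 + (poly g b)\<^sup>2"
  have B0: "0 \<le> B" by (simp add: B_def)
  have ab: "\<bar>a\<bar> \<le> R" "\<bar>b\<bar> \<le> R" using box[of 0] init by auto
  have "z t \<le> (z 0 + B / (2 * L + 1)) * exp ((2 * L + 1) * t) - B / (2 * L + 1)"
  proof (rule gronwall[where z' = z'])
    fix s assume s: "0 \<le> s" "s \<le> t"
    show "(z has_real_derivative z' s) (at s)"
      unfolding z_def z'_def X_def Y_def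
      by (auto intro!: derivative_eq_intros solution_components sol simp: algebra_simps)
    have 1: "\<bar>poly g (snd (\<gamma> s)) - poly g b\<bar> \<le> L * \<bar>Y s\<bar>"
      unfolding Y_def by (intro lip_g box ab)
    have 2: "\<bar>poly f (fst (\<gamma> s)) - poly f a\<bar> \<le> L * \<bar>X s\<bar>"
      unfolding X_def by (intro lip_f box ab)
    have am: "2 * (\<bar>X s\<bar> * \<bar>Y s\<bar>) \<le> z s"
      unfolding z_def using sum_squares_bound[of "\<bar>X s\<bar>" "\<bar>Y s\<bar>"] by simp
    have "X s * (poly g b - poly g (snd (\<gamma> s))) \<le> \<bar>X s\<bar> * (L * \<bar>Y s\<bar>)"
      using 1 2 by (auto intro!: mult_le_abs_mult simp: abs_minus_commute)
    moreover have "Y s * (poly f (fst (\<gamma> s)) - poly f a) \<le> \<bar>Y s\<bar> * (L * \<bar>X s\<bar>)"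
      using 1 2 by (auto intro!: mult_le_abs_mult simp: abs_minus_commute)
    moreover have "2 * X s * (- poly g b) \<le> (X s)\<^sup>2 + (poly g b)\<^sup>2"
      using sum_squares_bound[of "X s" "- poly g b"] by simp
    moreover have "2 * Y s * poly f a \<le> (Y s)\<^sup>2 + (poly f a)\<^sup>2"
      using sum_squares_bound[of "Y s" "poly f a"] by simp
    ultimately have "z' s \<le> 2 * L * (2 * (\<bar>X s\<bar> * \<bar>Y s\<bar>)) + z s + B"
      unfolding z'_def z_def B_def by (simp add: algebra_simps)
    also have "\<dots> \<le> 2 * L * z s + z s + B"
      using mult_left_mono[OF am, of "2 * L"] L by simp
    finally show "z' s \<le> (2 * L + 1) * z s + B" by (simp add: algebra_simps)
  qed (use L t in auto)
  also have "z 0 = 0" using init by (simp add: z_def X_def Y_def)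
  also have "(0 + B / (2 * L + 1)) * exp ((2 * L + 1) * t) - B / (2 * L + 1) \<le> B * exp ((2 * L + 1) * t)"
  proof -
    have "B / (2 * L + 1) \<le> B / 1" using L B0 by (intro divide_left_mono) auto
    then have "B / (2 * L + 1) * exp ((2 * L + 1) * t) \<le> B * exp ((2 * L + 1) * t)"
      by (intro mult_right_mono) auto
    moreover have "0 \<le> B / (2 * L + 1)" using L B0 by simp
    ultimately show ?thesis by simp
  qed
  finally show ?thesis by (simp add: z_def X_def Y_def B_def)
qed

lemma energy_conserved:
  assumes sol: "is_solution (separable_field f g) \<gamma>"
    and F: "\<And>x. (F has_real_derivative poly f x) (at x)"
    and G: "\<And>y. (G has_real_derivative poly g y) (at y)"
  shows "F (fst (\<gamma> s)) + G (snd (\<gamma> s)) = F (fst (\<gamma> t)) + G (snd (\<gamma> t))"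
proof -
  have "((\<lambda>t. F (fst (\<gamma> t)) + G (snd (\<gamma> t))) has_real_derivative 0) (at t)" for t
    using DERIV_add[OF DERIV_chain2[OF F solution_components(1)[OF sol, of t]]
      DERIV_chain2[OF G solution_components(2)[OF sol, of t]]] by (simp add: algebra_simps)
  then show ?thesis
    using DERIV_isconst_all[of "\<lambda>t. F (fst (\<gamma> t)) + G (snd (\<gamma> t))" s t] by blast
qed

lemma periodic_monotone_derivative_zero:
  fixes h h' :: "real \<Rightarrow> real"
  assumes der: "\<And>t. (h has_real_derivative h' t) (at t)" and sgn: "\<And>t. h' t \<le> 0"
    and T: "0 < T" "\<And>t. h (t + T) = h t"
  shows "h' t = 0"
proof -
  have mono: "h b \<le> h a" if "a \<le> b" for a b
    using DERIV_nonpos_imp_nonincreasing[OF that, of h] der sgn by blast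
  have const: "h s = h t" if "\<bar>t - s\<bar> < T" for s
  proof -
    have "h s \<le> h (t - T)" "h (t + T) \<le> h s" using mono[of "t - T" s] mono[of s "t + T"] that by linarith+
    then show ?thesis using T(2)[of t] T(2)[of "t - T"] by simp
  qed
  have "(h has_real_derivative 0) (at t)"
  proof (rule has_field_derivative_transform_within_open[of "\<lambda>_. h t" 0 t "{t - T<..<t + T}"])
    show "h t = h x" if "x \<in> {t - T<..<t + T}" for x
    proof -
      have "\<bar>t - x\<bar> < T" using that by (auto simp: abs_less_iff)
      then show ?thesis by (rule const[symmetric])
    qed
  qed (use T in auto)
  then show ?thesis using der DERIV_unique by blast
qed

section \<open>Potential wells and their normal form\<close>

text \<open>The potential is \<open>F(x) = x\<^sup>2 K(x)\<close>, and \<open>2K + xK' = p\<close> says that \<open>F'(x) = x p(x)\<close>. Positivity of \<open>p\<close> on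
  the interval \<open>S\<close> makes \<open>0\<close> a nondegenerate minimum of \<open>F\<close> and its only critical point in \<open>S\<close>.\<close>

locale potential_well =
  fixes S :: "real set" and p K :: "real poly"
  assumes open_S: "open S" and interval_S: "is_interval S" and zero_S: "0 \<in> S"
    and p_pos: "\<And>x. x \<in> S \<Longrightarrow> 0 < poly p x"
    and K_eq: "smult 2 K + pCons 0 (pderiv K) = p"
begin

definition F :: "real \<Rightarrow> real" where "F x = x\<^sup>2 * poly K x"
definition f :: "real poly" where "f = pCons 0 p"

text \<open>The signed square root of \<open>F\<close>. Extracting the factor \<open>x\<close> keeps it differentiable at \<open>0\<close>.\<close>

definition u :: "real \<Rightarrow> real" where "u x = x * sqrt (poly K x)"
definition u' :: "real \<Rightarrow> real" where "u' x = poly p x / (2 * sqrt (poly K x))"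
definition \<phi> :: "real \<Rightarrow> real" where "\<phi> = inv_into S u"
definition \<phi>' :: "real \<Rightarrow> real" where "\<phi>' v = inverse (u' (\<phi> v))"

lemma poly_p: "poly p x = 2 * poly K x + x * poly (pderiv K) x"
  using arg_cong[OF K_eq, of "\<lambda>q. poly q x"] by simp

lemma F_0 [simp]: "F 0 = 0"
  by (simp add: F_def)

lemma F_deriv: "(F has_real_derivative poly f x) (at x)"
  unfolding F_def f_def
  by (auto intro!: derivative_eq_intros simp: poly_p algebra_simps power2_eq_square)

lemma F_cont: "continuous_on A F"
  by (rule DERIV_continuous_on) (rule has_field_derivative_at_within[OF F_deriv])

lemma between_0_S: "x \<in> S \<Longrightarrow> 0 \<le> y \<Longrightarrow> y \<le> x \<Longrightarrow> y \<in> S"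
  and between_0_S': "x \<in> S \<Longrightarrow> y \<le> 0 \<Longrightarrow> x \<le> y \<Longrightarrow> y \<in> S"
  using interval_S zero_S by (meson is_interval_1)+

lemma f_pos: "x \<in> S \<Longrightarrow> 0 < x \<Longrightarrow> 0 < poly f x"
  and f_neg: "x \<in> S \<Longrightarrow> x < 0 \<Longrightarrow> poly f x < 0"
  by (auto simp: f_def p_pos mult_less_0_iff)

lemma f_eq_0_iff: "x \<in> S \<Longrightarrow> poly f x = 0 \<longleftrightarrow> x = 0"
  using p_pos[of x] by (auto simp: f_def)

lemma F_less:
  assumes "x \<in> S" "0 \<le> y" "y < x"
  shows "F y < F x"
proof (rule DERIV_pos_imp_increasing_open[OF assms(3) _ F_cont])
  fix z assume z: "y < z" "z < x"
  have "z \<in> S" by (rule between_0_S[OF assms(1)]) (use z assms in linarith)+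
  then have "0 < poly f z" by (rule f_pos) (use z assms in linarith)
  then show "\<exists>d. (F has_real_derivative d) (at z) \<and> 0 < d"
    by (intro exI[of _ "poly f z"] conjI F_deriv)
qed

lemma F_less_neg:
  assumes "x \<in> S" "y \<le> 0" "x < y"
  shows "F y < F x"
proof -
  have "- F x < - F y"
  proof (rule DERIV_pos_imp_increasing_open[OF assms(3)])
    fix z assume z: "x < z" "z < y"
    have "z \<in> S" by (rule between_0_S'[OF assms(1)]) (use z assms in linarith)+
    then have "poly f z < 0" by (rule f_neg) (use z assms in linarith)
    then have "0 < - poly f z" by simp
    then show "\<exists>d. ((\<lambda>x. - F x) has_real_derivative d) (at z) \<and> 0 < d"
      by (intro exI[of _ "- poly f z"] conjI DERIV_minus F_deriv)
  qed (intro continuous_intros F_cont)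
  then show ?thesis by simp
qed

lemma F_nonneg: "x \<in> S \<Longrightarrow> 0 \<le> F x"
  and F_pos: "x \<in> S \<Longrightarrow> x \<noteq> 0 \<Longrightarrow> 0 < F x"
  using F_less[of x 0] F_less_neg[of x 0] by (cases "x = 0"; cases "x < 0"; force)+

lemma F_scale_le:
  assumes "x \<in> S" "0 \<le> c" "c \<le> 1"
  shows "c * x \<in> S" "F (c * x) \<le> F x"
proof -
  have *: "c * x \<in> S \<and> F (c * x) \<le> F x"
  proof (cases "0 \<le> x")
    case True
    then have b: "0 \<le> c * x" "c * x \<le> x" using assms by (auto simp: mult_left_le_one_le)
    then have "c * x = x \<or> F (c * x) < F x" using F_less[OF assms(1) b(1)] by linarith
    then show ?thesis using between_0_S[OF assms(1) b] by auto
  next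
    case False
    then have b: "c * x \<le> 0" "x \<le> c * x" using assms
      by (auto simp: mult_nonneg_nonpos mult_le_cancel_right1)
    then have "c * x = x \<or> F (c * x) < F x" using F_less_neg[OF assms(1) b(1)] by linarith
    then show ?thesis using between_0_S'[OF assms(1) b] by auto
  qed
  from * show "c * x \<in> S" "F (c * x) \<le> F x" by auto
qed

lemma K_pos: "x \<in> S \<Longrightarrow> 0 < poly K x"
proof (cases "x = 0")
  case True
  then show ?thesis using poly_p[of 0] p_pos[OF zero_S] by simp
next
  case False
  moreover assume "x \<in> S"
  ultimately have "0 < F x" by (intro F_pos)
  then show ?thesis using False by (simp add: F_def zero_less_mult_iff)
qed

lemma u_square: "x \<in> S \<Longrightarrow> (u x)\<^sup>2 = F x"
  using K_pos[of x] by (simp add: u_def F_def power_mult_distrib)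

lemma u_deriv:
  assumes "x \<in> S"
  shows "(u has_real_derivative u' x) (at x)"
proof -
  have k: "0 < poly K x" using assms by (rule K_pos)
  have "(u has_real_derivative (sqrt (poly K x) + x * (poly (pderiv K) x * (inverse (sqrt (poly K x)) / 2)))) (at x)"
    unfolding u_def using k by (auto intro!: derivative_eq_intros simp: field_simps)
  also have "sqrt (poly K x) + x * (poly (pderiv K) x * (inverse (sqrt (poly K x)) / 2)) = u' x"
    using k by (simp add: u'_def poly_p field_simps)
  finally show ?thesis .
qed

lemma u'_pos: "x \<in> S \<Longrightarrow> 0 < u' x"
  using p_pos[of x] K_pos[of x] by (simp add: u'_def)

lemmas u_inverse = derivative_of_inverse[OF open_S interval_S u_deriv u'_pos, folded \<phi>_def]

lemma \<phi>_in_S: "v \<in> u ` S \<Longrightarrow> \<phi> v \<in> S"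
  and u_\<phi>: "v \<in> u ` S \<Longrightarrow> u (\<phi> v) = v"
  and \<phi>_u: "x \<in> S \<Longrightarrow> \<phi> (u x) = x"
  unfolding \<phi>_def using strict_mono_on_imp_inj_on[OF u_inverse(1)]
  by (auto intro: inv_into_into f_inv_into_f inv_into_f_f)

lemma F_\<phi>: "v \<in> u ` S \<Longrightarrow> F (\<phi> v) = v\<^sup>2"
  using u_square[OF \<phi>_in_S] by (simp add: u_\<phi>)

lemma \<phi>_deriv: "v \<in> u ` S \<Longrightarrow> (\<phi> has_real_derivative \<phi>' v) (at v)"
  unfolding \<phi>'_def by (rule u_inverse(5))

lemma \<phi>'_pos: "v \<in> u ` S \<Longrightarrow> 0 < \<phi>' v"
  unfolding \<phi>'_def using u'_pos[OF \<phi>_in_S] by simp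

text \<open>This is the derivative of the identity \<open>F(\<phi> v) = v\<^sup>2\<close>.\<close>

lemma f_\<phi>: "v \<in> u ` S \<Longrightarrow> poly f (\<phi> v) * \<phi>' v = 2 * v"
proof -
  assume v: "v \<in> u ` S"
  have k: "0 < poly K (\<phi> v)" and p: "0 < poly p (\<phi> v)"
    using K_pos p_pos \<phi>_in_S[OF v] by auto
  have "poly f (\<phi> v) * \<phi>' v = 2 * u (\<phi> v)"
    using p k by (simp add: f_def \<phi>'_def u'_def u_def field_simps)
  then show ?thesis using u_\<phi>[OF v] by simp
qed

lemma u_cont: "continuous_on S u"
  by (rule DERIV_continuous_on) (rule has_field_derivative_at_within[OF u_deriv])

lemma \<phi>_cont: "continuous_on (u ` S) \<phi>"
  by (rule u_inverse(4))

lemma \<phi>'_cont: "continuous_on (u ` S) \<phi>'"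
proof -
  have "continuous_on S u'"
    unfolding u'_def using K_pos by (intro continuous_intros) (auto simp: less_imp_neq[symmetric] dest!: K_pos)
  then have "continuous_on (u ` S) (\<lambda>v. u' (\<phi> v))"
    by (rule continuous_on_compose2[OF _ \<phi>_cont]) (auto simp: \<phi>_u)
  then show ?thesis
    unfolding \<phi>'_def using u'_pos[OF \<phi>_in_S] by (intro continuous_intros) (auto simp: less_imp_neq[symmetric] dest!: u'_pos[OF \<phi>_in_S])
qed

lemma u_0 [simp]: "u 0 = 0" by (simp add: u_def)

lemma \<phi>_0 [simp]: "\<phi> 0 = 0" using \<phi>_u[OF zero_S] by simp

lemma u_pos: "x \<in> S \<Longrightarrow> 0 < x \<Longrightarrow> 0 < u x"
  using K_pos[of x] by (simp add: u_def)

lemma \<phi>_neg: "v \<in> u ` S \<Longrightarrow> v < 0 \<Longrightarrow> \<phi> v < 0"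
proof -
  assume v: "v \<in> u ` S" "v < 0"
  then have "u (\<phi> v) < 0" by (simp add: u_\<phi>)
  then show "\<phi> v < 0" using K_pos[OF \<phi>_in_S[OF v(1)]] by (simp add: u_def mult_less_0_iff)
qed

lemma range_u:
  assumes "a \<in> S" "a < 0" "r\<^sup>2 \<le> F a" "b \<in> S" "0 < b" "r\<^sup>2 \<le> F b" "\<bar>v\<bar> \<le> r"
  shows "v \<in> u ` S"
proof -
  have "r \<le> u b" using assms u_pos[of b]
    by (intro power2_le_imp_le[of r]) (auto simp: u_square)
  moreover have "r \<le> - u a"
  proof (rule power2_le_imp_le)
    show "r\<^sup>2 \<le> (- u a)\<^sup>2" using assms by (simp add: u_square)
    show "0 \<le> - u a" using assms K_pos[of a] by (simp add: u_def mult_le_0_iff)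
  qed
  ultimately have "u a \<le> v" "v \<le> u b" using assms by linarith+
  then show ?thesis using u_inverse(3) assms by (meson is_interval_1 imageI)
qed

end

section \<open>The center of a separable system and its period annulus\<close>

text \<open>In the first case of \<open>S_cases\<close> the ovals will fill the plane; in the second one the period annulus
  ends at the energy of the equilibrium \<open>(c, 0)\<close>. The remaining assumptions make each energy level to
  be considered a closed curve.\<close>

locale separable_center = X: potential_well S p K + Y: potential_well UNIV q L
  for S p K q L +
  assumes S_cases: "S = UNIV \<and> (\<forall>e. \<exists>h>0. e < X.F h) \<or>
                    (\<exists>c>0. S = {..<c} \<and> (\<forall>x\<ge>c. poly p x \<le> 0))"
    and X_left: "\<And>e. \<exists>x\<in>S. x < 0 \<and> e \<le> X.F x"
    and Y_left: "\<And>e. \<exists>y<0. e \<le> Y.F y" and Y_right: "\<And>e. \<exists>y>0. e \<le> Y.F y"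
begin

definition vf :: "real \<times> real \<Rightarrow> real \<times> real" where "vf = separable_field X.f Y.f"
definition I :: "real set" where "I = {h \<in> S. 0 < h}"
definition level :: "real \<Rightarrow> (real \<times> real) set" where
  "level h = {(x, y). x \<in> S \<and> X.F x + Y.F y = X.F h}"

text \<open>The candidate for the period annulus together with the center. It is the inside of the loop
  through \<open>(c, 0)\<close> if \<open>S = {..<c}\<close>, and the whole plane if \<open>S = UNIV\<close>.\<close>

definition region :: "(real \<times> real) set" where
  "region = {(x, y). x \<in> S \<and> (\<exists>h\<in>I. X.F x + Y.F y < X.F h)}"

text \<open>The density of time: the flow moves along \<open>s \<mapsto> curve h s\<close> with \<open>dt = W h s ds\<close>.\<close>

definition W :: "real \<Rightarrow> real \<Rightarrow> real" where
  "W h s = X.\<phi>' (X.u h * cos s) * Y.\<phi>' (X.u h * sin s) / 2"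

text \<open>The level through \<open>(h, 0)\<close>, which is a circle of radius \<open>u h\<close> in the coordinates \<open>(u, v)\<close>.\<close>

definition curve :: "real \<Rightarrow> real \<Rightarrow> real \<times> real" where
  "curve h s = (X.\<phi> (X.u h * cos s), Y.\<phi> (X.u h * sin s))"
definition period :: "real \<Rightarrow> real" where "period h = integral {0..2 * pi} (W h)"

lemma r_pos: "h \<in> I \<Longrightarrow> 0 < X.u h"
  unfolding I_def by (auto intro: X.u_pos)

lemma in_range_X:
  assumes h: "h \<in> I" and v: "\<bar>v\<bar> \<le> X.u h"
  shows "v \<in> X.u ` S"
proof -
  obtain a where "a \<in> S" "a < 0" "X.F h \<le> X.F a" using X_left by blast
  then show ?thesis using h v X.u_square[of h] unfolding I_def
    by (intro X.range_u[of a "X.u h" h v]) auto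
qed

lemma in_range_Y: "v \<in> range Y.u"
proof -
  obtain a b where "a < 0" "v\<^sup>2 \<le> Y.F a" "0 < b" "v\<^sup>2 \<le> Y.F b" using Y_left Y_right by blast
  then show ?thesis by (intro Y.range_u[of a "\<bar>v\<bar>" b v]) auto
qed

lemma abs_r_cos: "h \<in> I \<Longrightarrow> \<bar>X.u h * cos s\<bar> \<le> X.u h"
  using r_pos[of h] by (simp add: abs_mult mult_left_le)

lemma cos_range: "h \<in> I \<Longrightarrow> X.u h * cos s \<in> X.u ` S"
  by (rule in_range_X[OF _ abs_r_cos])

lemma W_pos: "h \<in> I \<Longrightarrow> 0 < W h s"
  unfolding W_def using X.\<phi>'_pos[OF cos_range] Y.\<phi>'_pos[OF in_range_Y] by simp

lemma W_cont: "continuous_on (I \<times> UNIV) (\<lambda>(h, s). W h s)"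
proof -
  have u: "continuous_on (I \<times> UNIV) (\<lambda>z. X.u (fst z))"
    by (rule continuous_on_compose2[OF X.u_cont]) (auto simp: I_def intro: continuous_intros)
  have 1: "continuous_on (I \<times> UNIV) (\<lambda>z. X.\<phi>' (X.u (fst z) * cos (snd z)))"
    by (rule continuous_on_compose2[OF X.\<phi>'_cont])
      (use u in \<open>auto intro!: continuous_intros cos_range\<close>)
  have 2: "continuous_on (I \<times> UNIV) (\<lambda>z. Y.\<phi>' (X.u (fst z) * sin (snd z)))"
    by (rule continuous_on_compose2[OF Y.\<phi>'_cont])
      (use u in_range_Y in \<open>auto intro!: continuous_intros\<close>)
  show ?thesis unfolding W_def split_beta by (intro continuous_intros 1 2) auto
qed

lemma period_cont: "continuous_on I period"
proof -
  have "continuous_on (I \<times> cbox 0 (2 * pi)) (\<lambda>(h, s). W h s)"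
    using W_cont by (rule continuous_on_subset) auto
  from integral_continuous_on_param[OF this] show ?thesis
    unfolding period_def by simp
qed

lemma clock:
  assumes h: "h \<in> I"
  obtains \<tau> \<Theta> where
    "\<And>s. (\<tau> has_real_derivative W h s) (at s)" "\<tau> 0 = 0" "\<tau> (2 * pi) = period h" "0 < period h"
    "\<And>t. (\<Theta> has_real_derivative inverse (W h (\<Theta> t))) (at t)"
    "\<And>t. \<tau> (\<Theta> t) = t" "\<And>s. \<Theta> (\<tau> s) = s" "\<And>s. \<tau> (s + 2 * pi) = \<tau> s + period h" "strict_mono \<tau>"
proof -
  have P: "continuous_on UNIV (\<lambda>s. (h, s))"
    by (intro continuous_on_Pair continuous_on_const continuous_on_id)
  have c: "continuous_on UNIV (W h)"
    using continuous_on_compose2[OF W_cont P] h by auto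
  have p: "W h (s + 2 * pi) = W h s" for s by (simp add: W_def)
  have "(0::real) < 2 * pi" by simp
  from periodic_clock[OF c W_pos[OF h] p this] show ?thesis
    by (metis that period_def)
qed

lemma curve_deriv:
  assumes h: "h \<in> I"
  shows "((\<lambda>s. fst (curve h s)) has_real_derivative - poly Y.f (snd (curve h s)) * W h s) (at s)"
    and "((\<lambda>s. snd (curve h s)) has_real_derivative poly X.f (fst (curve h s)) * W h s) (at s)"
proof -
  let ?r = "X.u h"
  have "((\<lambda>s. X.\<phi> (?r * cos s)) has_real_derivative X.\<phi>' (?r * cos s) * (- (?r * sin s))) (at s)"
    by (rule DERIV_chain2[where f = X.\<phi> and g = "\<lambda>s. ?r * cos s" and x = s, OF X.\<phi>_deriv[OF cos_range[OF h, of s]]]) (auto intro!: derivative_eq_intros)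
  moreover have "X.\<phi>' (?r * cos s) * (- (?r * sin s)) = - poly Y.f (snd (curve h s)) * W h s"
    using Y.f_\<phi>[OF in_range_Y, of "?r * sin s"] by (simp add: curve_def W_def)
  ultimately show "((\<lambda>s. fst (curve h s)) has_real_derivative - poly Y.f (snd (curve h s)) * W h s) (at s)"
    by (simp add: curve_def)
  have "((\<lambda>s. Y.\<phi> (?r * sin s)) has_real_derivative Y.\<phi>' (?r * sin s) * (?r * cos s)) (at s)"
    by (rule DERIV_chain2[where f = Y.\<phi> and g = "\<lambda>s. ?r * sin s" and x = s, OF Y.\<phi>_deriv[OF in_range_Y, of "?r * sin s"]]) (auto intro!: derivative_eq_intros)
  moreover have "Y.\<phi>' (?r * sin s) * (?r * cos s) = poly X.f (fst (curve h s)) * W h s"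
    using X.f_\<phi>[OF cos_range[OF h], of s] by (simp add: curve_def W_def)
  ultimately show "((\<lambda>s. snd (curve h s)) has_real_derivative poly X.f (fst (curve h s)) * W h s) (at s)"
    by (simp add: curve_def)
qed

lemma curve_0: "h \<in> I \<Longrightarrow> curve h 0 = (h, 0)"
  by (simp add: curve_def X.\<phi>_u I_def)

lemma curve_periodic: "curve h (s + 2 * pi) = curve h s"
  by (simp add: curve_def)

lemma range_curve:
  assumes h: "h \<in> I"
  shows "range (curve h) = level h"
proof (intro subset_antisym subsetI)
  fix z assume "z \<in> range (curve h)"
  then obtain s where "z = curve h s" by blast
  moreover have "(X.u h * cos s)\<^sup>2 + (X.u h * sin s)\<^sup>2 = (X.u h)\<^sup>2"
    by (simp add: power_mult_distrib flip: distrib_left)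
  ultimately show "z \<in> level h"
    using X.\<phi>_in_S[OF cos_range[OF h]] X.F_\<phi>[OF cos_range[OF h]] Y.F_\<phi>[OF in_range_Y]
      X.u_square[of h] h
    by (simp add: curve_def level_def I_def)
next
  fix z assume "z \<in> level h"
  then obtain x y where z: "z = (x, y)" "x \<in> S" "X.F x + Y.F y = X.F h" by (auto simp: level_def)
  have r: "0 < X.u h" using h by (rule r_pos)
  have "(X.u x)\<^sup>2 + (Y.u y)\<^sup>2 = (X.u h)\<^sup>2"
    using z h by (simp add: X.u_square Y.u_square I_def)
  then have "(X.u x / X.u h)\<^sup>2 + (Y.u y / X.u h)\<^sup>2 = 1"
    using r by (simp add: power_divide flip: add_divide_distrib)
  then obtain s where "X.u x / X.u h = cos s" "Y.u y / X.u h = sin s" by (rule sincos_total_2pi)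
  then have "X.u x = X.u h * cos s" "Y.u y = X.u h * sin s" using r by (auto simp: field_simps)
  then have "curve h s = (X.\<phi> (X.u x), Y.\<phi> (Y.u y))" by (simp add: curve_def)
  then have "curve h s = z" using z by (simp add: X.\<phi>_u Y.\<phi>_u)
  then show "z \<in> range (curve h)" by blast
qed

text \<open>The curve of the level, run through with the clock of \<open>W\<close>. It is back at \<open>(h, 0)\<close> only after a full
  turn, as the angle increases and \<open>u\<close> attains its maximum on the level only there.\<close>

lemma orbit_through:
  assumes h: "h \<in> I"
  obtains \<gamma> where "is_solution vf \<gamma>" "\<gamma> 0 = (h, 0)" "\<And>t. \<gamma> (t + period h) = \<gamma> t"
    "range \<gamma> = level h" "\<And>t. 0 < t \<Longrightarrow> \<gamma> t = (h, 0) \<Longrightarrow> period h \<le> t" "0 < period h"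
proof -
  obtain \<tau> \<Theta> where \<tau>: "\<tau> 0 = 0" "\<tau> (2 * pi) = period h" "0 < period h"
    and \<Theta>: "\<And>t. (\<Theta> has_real_derivative inverse (W h (\<Theta> t))) (at t)"
    and inv: "\<And>t. \<tau> (\<Theta> t) = t" "\<And>s. \<Theta> (\<tau> s) = s"
    and shift: "\<And>s. \<tau> (s + 2 * pi) = \<tau> s + period h" and mono: "strict_mono \<tau>"
    using clock[OF h] by metis
  define \<gamma> where "\<gamma> t = curve h (\<Theta> t)" for t
  show ?thesis
  proof (rule that)
    have "((\<lambda>t. fst (\<gamma> t)) has_real_derivative - poly Y.f (snd (\<gamma> t))) (at t)"
         "((\<lambda>t. snd (\<gamma> t)) has_real_derivative poly X.f (fst (\<gamma> t))) (at t)" for t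
      unfolding \<gamma>_def
      using DERIV_chain2[OF curve_deriv(1)[OF h] \<Theta>[of t]] DERIV_chain2[OF curve_deriv(2)[OF h] \<Theta>[of t]]
        W_pos[OF h, of "\<Theta> t"]
      by (simp_all add: mult.assoc)
    then show "is_solution vf \<gamma>" unfolding vf_def is_solution_separable_iff by blast
    have \<Theta>0: "\<Theta> 0 = 0" using inv(2)[of 0] \<tau>(1) by simp
    then show "\<gamma> 0 = (h, 0)" by (simp add: \<gamma>_def curve_0[OF h])
    have "\<Theta> (t + period h) = \<Theta> t + 2 * pi" for t
      using shift[of "\<Theta> t"] inv by metis
    then show "\<gamma> (t + period h) = \<gamma> t" for t by (simp add: \<gamma>_def curve_periodic)
    have "range \<gamma> = curve h ` range \<Theta>" by (auto simp: \<gamma>_def)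
    also have "range \<Theta> = UNIV" using inv(2) by (metis UNIV_eq_I rangeI)
    finally show "range \<gamma> = level h" using range_curve[OF h] by simp
    show "period h \<le> t" if t: "0 < t" "\<gamma> t = (h, 0)" for t
    proof -
      have "X.u (X.\<phi> (X.u h * cos (\<Theta> t))) = X.u h" using t by (simp add: \<gamma>_def curve_def)
      then have "X.u h * cos (\<Theta> t) = X.u h" using X.u_\<phi>[OF cos_range[OF h]] by simp
      then have "cos (\<Theta> t) = 1" using r_pos[OF h] by simp
      then obtain n :: int where n: "\<Theta> t = real_of_int n * 2 * pi" using cos_one_2pi_int by blast
      have "0 < \<Theta> t"
      proof (rule ccontr)
        assume "\<not> 0 < \<Theta> t"
        then have "\<tau> (\<Theta> t) \<le> \<tau> 0" using mono by (simp add: strict_mono_less_eq)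
        then show False using t inv \<tau> by simp
      qed
      then have "0 < n" using n by (simp add: zero_less_mult_iff)
      then have "1 \<le> real_of_int n" by simp
      then have "2 * pi \<le> \<Theta> t" using n by simp
      then have "\<tau> (2 * pi) \<le> \<tau> (\<Theta> t)" using mono by (simp add: strict_mono_less_eq)
      then show ?thesis using \<tau> inv by simp
    qed
  qed (fact \<tau>(3))
qed

text \<open>By uniqueness, every solution through \<open>(h, 0)\<close> agrees with the one from \<open>orbit_through\<close> for positive
  times.\<close>

lemma minimal_period_eq:
  assumes h: "h \<in> I"
  shows "minimal_period vf (h, 0) = period h"
  unfolding minimal_period_def
proof (rule Least_equality)
  obtain \<gamma> where \<gamma>: "is_solution vf \<gamma>" "\<gamma> 0 = (h, 0)" "\<And>t. \<gamma> (t + period h) = \<gamma> t"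
    "\<And>t. 0 < t \<Longrightarrow> \<gamma> t = (h, 0) \<Longrightarrow> period h \<le> t" "0 < period h"
    using orbit_through[OF h] by metis
  then show "0 < period h \<and> (\<exists>\<gamma>. is_solution vf \<gamma> \<and> \<gamma> 0 = (h, 0) \<and> (\<forall>t. \<gamma> (t + period h) = \<gamma> t))"
    by blast
  fix T assume "0 < T \<and> (\<exists>\<delta>. is_solution vf \<delta> \<and> \<delta> 0 = (h, 0) \<and> (\<forall>t. \<delta> (t + T) = \<delta> t))"
  then obtain \<delta> where \<delta>: "0 < T" "is_solution vf \<delta>" "\<delta> 0 = (h, 0)" "\<And>t. \<delta> (t + T) = \<delta> t" by blast
  have "\<gamma> T = \<delta> T"
    using solution_unique[of X.f Y.f \<gamma> \<delta> T] \<gamma> \<delta> by (simp add: vf_def)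
  also have "\<delta> T = (h, 0)" using \<delta>(3) \<delta>(4)[of 0] by simp
  finally show "period h \<le> T" using \<gamma>(4) \<delta>(1) by blast
qed

lemma leftmost_point:
  assumes h: "h \<in> I"
  obtains a where "a < 0" "(a, 0) \<in> level h"
proof -
  have "(X.\<phi> (- X.u h), 0) = curve h pi" by (simp add: curve_def)
  then have "(X.\<phi> (- X.u h), 0) \<in> level h" using range_curve[OF h] by blast
  moreover have "X.\<phi> (- X.u h) < 0"
    using r_pos[OF h] by (intro X.\<phi>_neg in_range_X[OF h]) auto
  ultimately show ?thesis using that by blast
qed

lemma level_periodic_orbit:
  assumes h: "h \<in> I"
  shows "level h \<in> periodic_orbits vf"
proof -
  obtain \<gamma> where \<gamma>: "is_solution vf \<gamma>" "\<gamma> 0 = (h, 0)" "\<And>t. \<gamma> (t + period h) = \<gamma> t"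
    "range \<gamma> = level h" "0 < period h"
    using orbit_through[OF h] by metis
  obtain a where a: "a < 0" "(a, 0) \<in> level h" using leftmost_point[OF h] .
  then obtain t where "\<gamma> t = (a, 0)" using \<gamma>(4) by (metis rangeE)
  then have "\<gamma> t \<noteq> \<gamma> 0" using a h \<gamma>(2) by (auto simp: I_def)
  then have "\<not> \<gamma> constant_on UNIV" by (metis UNIV_I constant_on_def)
  then show ?thesis unfolding periodic_orbits_def using \<gamma> by blast
qed

definition energy :: "real \<times> real \<Rightarrow> real" where "energy z = X.F (fst z) + Y.F (snd z)"

lemma nonpos_in_S: "x \<le> 0 \<Longrightarrow> x \<in> S"
  using S_cases by auto

lemma energy_cont: "continuous_on A energy"
  unfolding energy_def
  by (intro continuous_intros continuous_on_compose2[OF X.F_cont] continuous_on_compose2[OF Y.F_cont]) auto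

lemma energy_const:
  assumes "is_solution vf \<gamma>"
  shows "energy (\<gamma> s) = energy (\<gamma> t)"
  unfolding energy_def
  by (rule energy_conserved[OF assms[unfolded vf_def] X.F_deriv Y.F_deriv])

text \<open>At the rightmost point of the orbit \<open>x' = 0\<close>, hence \<open>y = 0\<close>. If this point did not lie on the
  positive half-axis, then \<open>y' = f(x) \<le> 0\<close> along the whole orbit; since \<open>y\<close> is periodic, it would be
  constant, and the orbit would be the origin.\<close>

lemma periodic_orbit_crosses_axis:
  assumes "C \<in> periodic_orbits vf"
  obtains x where "0 < x" "(x, 0) \<in> C" "\<And>z. z \<in> C \<Longrightarrow> energy z = X.F x"
proof -
  from assms obtain \<gamma> T where C: "C = range \<gamma>" and sol: "is_solution vf \<gamma>"
    and nc: "\<not> \<gamma> constant_on UNIV" and T: "0 < T" "\<And>t. \<gamma> (t + T) = \<gamma> t"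
    unfolding periodic_orbits_def by blast
  note sol' = sol[unfolded vf_def]
  obtain t0 where t0: "\<And>t. t \<in> {0..T} \<Longrightarrow> fst (\<gamma> t) \<le> fst (\<gamma> t0)"
    using continuous_attains_sup[OF compact_Icc _ solution_continuous(1)[OF sol'], of 0 T] T(1)
    by (metis atLeastatMost_empty_iff2 less_imp_le not_le)
  have max: "fst (\<gamma> t) \<le> fst (\<gamma> t0)" for t
    using periodic_representative[of T \<gamma> t, OF T] t0 by (metis atLeastAtMost_iff)
  have "- poly Y.f (snd (\<gamma> t0)) = 0"
    by (rule DERIV_local_max[OF solution_components(1)[OF sol'], of 1]) (use max in auto)
  then have y0: "snd (\<gamma> t0) = 0" using Y.f_eq_0_iff by simp
  have "0 < fst (\<gamma> t0)"
  proof (rule ccontr)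
    assume "\<not> 0 < fst (\<gamma> t0)"
    then have neg: "fst (\<gamma> t) \<le> 0" for t using max[of t] by simp
    have "poly X.f (fst (\<gamma> t)) \<le> 0" for t
      using X.f_neg[OF nonpos_in_S[OF neg], of t] neg[of t] by (cases "fst (\<gamma> t) = 0") (auto simp: X.f_def)
    then have "poly X.f (fst (\<gamma> t)) = 0" for t
      using periodic_monotone_derivative_zero[OF solution_components(2)[OF sol'] _ T(1)] T(2) by simp
    then have x: "fst (\<gamma> t) = 0" for t using X.f_eq_0_iff[OF nonpos_in_S[OF neg]] by blast
    have "((\<lambda>t. 0) has_real_derivative - poly Y.f (snd (\<gamma> t))) (at t)" for t
      using solution_components(1)[OF sol', of t] by (simp add: x)
    then have "- poly Y.f (snd (\<gamma> t)) = 0" for t using DERIV_const DERIV_unique by blast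
    then have "snd (\<gamma> t) = 0" for t using Y.f_eq_0_iff by simp
    then have "\<gamma> t = (0, 0)" for t using x[of t] by (simp add: prod_eq_iff)
    then show False using nc by (auto simp: constant_on_def)
  qed
  moreover have "(fst (\<gamma> t0), 0) = \<gamma> t0" using y0 by (simp add: prod_eq_iff)
  moreover have "energy (\<gamma> t) = X.F (fst (\<gamma> t0))" for t
    using energy_const[OF sol, of t t0] y0 by (simp add: energy_def)
  ultimately show ?thesis by (intro that[of "fst (\<gamma> t0)"]) (auto simp: C)
qed

lemma I_eq: "I = S \<inter> {0<..}"
  by (auto simp: I_def)

lemma I_open: "open I"
  unfolding I_eq by (intro open_Int X.open_S open_greaterThan)

lemma I_interval: "is_interval I"
  unfolding I_eq by (intro is_interval_Int X.interval_S) (simp add: is_interval_1)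

lemma I_mono: "strict_mono_on I X.F"
  by (rule strict_mono_onI) (auto simp: I_def intro: X.F_less)

lemma I_extend:
  assumes "h \<in> I"
  obtains h' where "h' \<in> I" "h < h'"
proof -
  obtain e where "0 < e" "ball h e \<subseteq> I" using I_open assms openE by blast
  then have "h + e / 2 \<in> I" by (auto simp: subset_iff dist_real_def)
  then show ?thesis using that[of "h + e / 2"] \<open>0 < e\<close> by simp
qed

lemma I_nonempty: "I \<noteq> {}"
proof -
  obtain e where e: "0 < e" "ball 0 e \<subseteq> S" using X.open_S X.zero_S openE by blast
  then have "e / 2 \<in> S" by (auto simp: subset_iff dist_real_def)
  then show ?thesis using e unfolding I_def by force
qed

lemma F_intermediate:
  assumes "h \<in> I" "0 < e" "e < X.F h"
  obtains h' where "h' \<in> I" "h' < h" "X.F h' = e"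
proof -
  have "\<exists>x\<ge>0. x \<le> h \<and> X.F x = e"
    using assms by (intro IVT' X.F_cont) (auto simp: I_def)
  then obtain x where x: "0 \<le> x" "x \<le> h" "X.F x = e" by blast
  have "x \<noteq> 0" "x \<noteq> h" using x assms X.F_0 by auto
  then show ?thesis using that[of x] x assms X.between_0_S[of h x] by (auto simp: I_def)
qed

lemma level_subset_region:
  assumes "h \<in> I"
  shows "level h \<subseteq> region - {(0, 0)}"
proof -
  obtain h' where "h' \<in> I" "h < h'" using I_extend[OF assms] .
  then have "X.F h < X.F h'" using I_mono assms by (simp add: strict_mono_on_def)
  then show ?thesis
    using \<open>h' \<in> I\<close> X.F_pos[of h] assms by (auto simp: level_def region_def I_def)
qed

lemma region_in_level:
  assumes "z \<in> region - {(0, 0)}"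
  obtains h where "h \<in> I" "z \<in> level h"
proof -
  obtain x y h where z: "z = (x, y)" "x \<in> S" "h \<in> I" "X.F x + Y.F y < X.F h"
    using assms by (auto simp: region_def)
  have "x \<noteq> 0 \<or> y \<noteq> 0" using assms z by auto
  then have "0 < X.F x + Y.F y"
    using z X.F_nonneg[of x] X.F_pos[of x] Y.F_nonneg[of y] Y.F_pos[of y]
    by (auto intro: add_pos_nonneg add_nonneg_pos)
  then obtain h' where "h' \<in> I" "X.F h' = X.F x + Y.F y" using F_intermediate[OF z(3) _ z(4)] by metis
  then show ?thesis using that[of h'] z by (auto simp: level_def)
qed

lemma region_open: "open region"
proof -
  have eq: "region = (\<Union>h\<in>I. (S \<times> UNIV) \<inter> {z. energy z < X.F h})"
    by (auto simp: region_def energy_def)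
  have "open {z. energy z < X.F h}" for h
    by (intro open_Collect_less continuous_on_const energy_cont)
  then show ?thesis
    unfolding eq using X.open_S by (intro open_UN ballI open_Int open_Times open_UNIV) auto
qed

lemma origin_in_region: "(0, 0) \<in> region"
proof -
  obtain h where "h \<in> I" using I_nonempty by blast
  then show ?thesis using X.F_pos[of h] X.zero_S by (auto simp: region_def I_def)
qed

text \<open>Both potentials increase away from \<open>0\<close>, so the region is star-shaped.\<close>

lemma region_connected: "connected region"
proof (rule starlike_imp_connected)
  have "closed_segment (0, 0) z \<subseteq> region" if z: "z \<in> region" for z
  proof
    fix w assume "w \<in> closed_segment (0, 0) z"
    then obtain c where c: "0 \<le> c" "c \<le> 1" "w = c *\<^sub>R z"
      unfolding closed_segment_def by (auto simp: zero_prod_def[symmetric])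
    obtain x y h where xy: "z = (x, y)" "x \<in> S" "h \<in> I" "X.F x + Y.F y < X.F h"
      using z by (auto simp: region_def)
    have "c * x \<in> S" "X.F (c * x) + Y.F (c * y) \<le> X.F x + Y.F y"
      using X.F_scale_le[OF xy(2) c(1,2)] Y.F_scale_le[of y, OF _ c(1,2)] by auto
    then show "w \<in> region" using xy c(3) unfolding region_def by force
  qed
  then show "starlike region" unfolding starlike_def using origin_in_region by blast
qed

lemma region_periodic: "region - {(0, 0)} \<subseteq> \<Union> (periodic_orbits vf)"
proof
  fix z assume "z \<in> region - {(0, 0)}"
  then obtain h where "h \<in> I" "z \<in> level h" by (rule region_in_level)
  then show "z \<in> \<Union> (periodic_orbits vf)" using level_periodic_orbit by blast
qed

lemma vf_origin: "vf (0, 0) = 0"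
  by (simp add: vf_def separable_field_def X.f_def Y.f_def zero_prod_def)

lemma center: "is_center vf (0, 0)"
  unfolding is_center_def using vf_origin region_open origin_in_region region_periodic by blast

lemma F_le_F_boundary:
  assumes "S = {..<c}" "0 < c" "\<And>x. c \<le> x \<Longrightarrow> poly p x \<le> 0" "0 \<le> x"
  shows "X.F x \<le> X.F c" and "x < c \<Longrightarrow> X.F x < X.F c"
proof -
  show *: "X.F x < X.F c" if "x < c"
  proof (rule DERIV_pos_imp_increasing_open[OF that _ X.F_cont])
    fix z assume "x < z" "z < c"
    then have "0 < poly X.f z" using assms by (intro X.f_pos) auto
    then show "\<exists>d. (X.F has_real_derivative d) (at z) \<and> 0 < d"
      by (intro exI[of _ "poly X.f z"] conjI X.F_deriv)
  qed
  show "X.F x \<le> X.F c"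
  proof (cases "x < c")
    case False
    then have "c \<le> x" by simp
    then show ?thesis
    proof (rule DERIV_nonpos_imp_nonincreasing)
      fix z assume "c \<le> z" "z \<le> x"
      then have "poly X.f z \<le> 0" using assms by (auto simp: X.f_def intro: mult_nonneg_nonpos)
      then show "\<exists>d. (X.F has_real_derivative d) (at z) \<and> d \<le> 0"
        by (intro exI[of _ "poly X.f z"] conjI X.F_deriv)
    qed
  qed (use * in simp)
qed

text \<open>Let \<open>S = {..<c}\<close>. Every periodic orbit meets the positive half-axis, where \<open>F \<le> F(c)\<close>, so its energy
  is at most \<open>F(c)\<close>. Moving away from the \<open>x\<close>-axis raises the energy; as \<open>V\<close> is open, its energies are
  therefore strictly below \<open>F(c)\<close>. The line \<open>x = c\<close> carries only energies at least \<open>F(c)\<close>, so the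
  connected set \<open>V\<close> cannot cross it.\<close>

lemma annulus_maximal:
  assumes V: "open V" "connected V" "(0, 0) \<in> V" "V - {(0, 0)} \<subseteq> \<Union> (periodic_orbits vf)"
  shows "V \<subseteq> region"
  using S_cases
proof (elim disjE conjE exE)
  assume UNIV: "S = UNIV" "\<forall>e. \<exists>h>0. e < X.F h"
  show ?thesis unfolding region_def I_def using UNIV by auto
next
  fix c assume c: "0 < c" "S = {..<c}" "\<forall>x\<ge>c. poly p x \<le> 0"
  have le: "energy z \<le> X.F c" if z: "z \<in> V" for z
  proof (cases "z = (0, 0)")
    case True
    then show ?thesis using F_le_F_boundary(1)[of c 0] c by (simp add: energy_def)
  next
    case False
    then obtain C where "C \<in> periodic_orbits vf" "z \<in> C" using V(4) z by blast
    then obtain x where "0 < x" "energy z = X.F x" by (metis periodic_orbit_crosses_axis)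
    then show ?thesis using F_le_F_boundary(1)[of c x] c by simp
  qed
  have less: "energy z < X.F c" if z: "z \<in> V" for z
  proof -
    obtain x y where xy: "z = (x, y)" by (cases z)
    obtain A B where AB: "open A" "open B" "x \<in> A" "y \<in> B" "A \<times> B \<subseteq> V"
      using open_prod_elim[OF V(1) z] xy by (metis mem_Times_iff fst_conv snd_conv)
    obtain e where e: "0 < e" "ball y e \<subseteq> B" using AB openE by blast
    define y' where "y' = (if 0 \<le> y then y + e / 2 else y - e / 2)"
    have "y' \<in> ball y e" using e by (auto simp: y'_def dist_real_def)
    then have "energy (x, y') \<le> X.F c" using AB e by (intro le) auto
    moreover have "Y.F y < Y.F y'"
      using e Y.F_less[of y' y] Y.F_less_neg[of y' y] by (auto simp: y'_def)
    ultimately show ?thesis by (simp add: energy_def xy)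
  qed
  have nc: "c \<notin> fst ` V"
  proof
    assume "c \<in> fst ` V"
    then obtain y where "(c, y) \<in> V" by force
    then have "energy (c, y) < X.F c" by (rule less)
    then show False using Y.F_nonneg[of y] by (simp add: energy_def)
  qed
  have "connected (fst ` V)" using V(2) by (intro connected_continuous_image continuous_intros)
  then have "is_interval (fst ` V)" by (simp add: is_interval_connected_1)
  moreover have "0 \<in> fst ` V" using V(3) by force
  ultimately have xc: "x < c" if "x \<in> fst ` V" for x
    using nc c(1) that unfolding is_interval_1 by (metis linorder_not_less order_less_imp_le)
  show ?thesis
  proof
    fix z assume z: "z \<in> V"
    have x: "fst z \<in> S" using xc z c by auto
    then have "0 \<le> energy z" using X.F_nonneg Y.F_nonneg by (simp add: energy_def)
    then have "0 < (energy z + X.F c) / 2" "(energy z + X.F c) / 2 < X.F c" and E: "energy z < (energy z + X.F c) / 2"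
      using less[OF z] by auto
    moreover have "\<exists>h\<ge>0. h \<le> c \<and> X.F h = (energy z + X.F c) / 2"
      using calculation c by (intro IVT' X.F_cont) auto
    ultimately obtain h where h: "0 \<le> h" "h \<le> c" "X.F h = (energy z + X.F c) / 2"
      "h \<noteq> 0" "h \<noteq> c" by (metis X.F_0 less_irrefl)
    then have "h \<in> S" "0 < h" unfolding c(2) by auto
    then have "h \<in> I" by (simp add: I_def)
    then show "z \<in> region" using x E h(3) unfolding region_def energy_def by (cases z) force
  qed
qed

lemma annulus_eq: "period_annulus vf (0, 0) = region - {(0, 0)}"
  unfolding period_annulus_def
  using annulus_maximal region_open region_connected origin_in_region region_periodic by blast

text \<open>Since \<open>F\<close> is injective on \<open>I\<close>, the energy of an orbit determines its point on the section.\<close>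

lemma global_section:
  "global_transversal_section vf (period_annulus vf (0, 0)) I (\<lambda>h. (h, 0))"
  unfolding global_transversal_section_def
proof (intro conjI ballI impI)
  show "open I" "is_interval I" "I \<noteq> {}" by (fact I_open I_interval I_nonempty)+
  have der: "((\<lambda>h. (h, 0)) has_vector_derivative (1, 0)) (at h)" for h :: real
    by (intro has_vector_derivative_Pair has_vector_derivative_const has_vector_derivative_id)
  show "smooth_curve_on I (\<lambda>h. (h, 0))"
    unfolding smooth_curve_on_def
    by (rule exI[of _ "\<lambda>k. case k of 0 \<Rightarrow> (\<lambda>h. (h, 0)) | Suc 0 \<Rightarrow> (\<lambda>h. (1, 0)) | _ \<Rightarrow> (\<lambda>h. 0)"])
      (auto split: nat.splits intro: der)
  show "transversal_on vf I (\<lambda>h. (h, 0))"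
    unfolding transversal_on_def
    using X.f_pos by (auto simp: Let_def vector_derivative_at[OF der] vf_def separable_field_def I_def less_imp_neq[symmetric])
  show "(\<lambda>h. (h, 0)) ` I \<subseteq> period_annulus vf (0, 0)"
  proof -
    have "(h, 0) \<in> level h" if "h \<in> I" for h using that by (simp add: level_def I_def)
    then show ?thesis unfolding annulus_eq using level_subset_region by blast
  qed
  fix C assume C: "C \<in> periodic_orbits vf" "C \<subseteq> period_annulus vf (0, 0)"
  obtain x where x: "0 < x" "(x, 0) \<in> C" "\<And>z. z \<in> C \<Longrightarrow> energy z = X.F x"
    using periodic_orbit_crosses_axis[OF C(1)] by blast
  then have "x \<in> I" using C(2) unfolding annulus_eq by (auto simp: region_def I_def)
  moreover have "h = x" if "h \<in> I" "(h, 0) \<in> C" for h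
  proof -
    have "X.F h = X.F x" using x(3)[OF that(2)] by (simp add: energy_def)
    then show ?thesis using strict_mono_on_imp_inj_on[OF I_mono] \<open>x \<in> I\<close> that(1)
      by (meson inj_onD)
  qed
  ultimately show "\<exists>!h. h \<in> I \<and> (h, 0) \<in> C" using x(2) by blast
qed

lemma period_function_eq: "h \<in> I \<Longrightarrow> period_function vf (\<lambda>h. (h, 0)) h = period h"
  by (simp add: period_function_def minimal_period_eq)

section \<open>Bounds for the period\<close>

lemma curve_in_level: "h \<in> I \<Longrightarrow> curve h s \<in> level h"
  using range_curve by blast

lemma f_sign:
  assumes "h \<in> I"
  shows "0 \<le> cos s \<Longrightarrow> 0 \<le> poly X.f (fst (curve h s))"
    and "cos s \<le> 0 \<Longrightarrow> poly X.f (fst (curve h s)) \<le> 0"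
proof -
  have e: "poly X.f (fst (curve h s)) * X.\<phi>' (X.u h * cos s) = 2 * (X.u h * cos s)"
    using X.f_\<phi>[OF cos_range[OF assms]] by (simp add: curve_def)
  have p: "0 < X.\<phi>' (X.u h * cos s)" "0 < X.u h"
    using X.\<phi>'_pos[OF cos_range[OF assms]] r_pos[OF assms] by auto
  show "0 \<le> poly X.f (fst (curve h s))" if "0 \<le> cos s"
  proof -
    have "0 \<le> poly X.f (fst (curve h s)) * X.\<phi>' (X.u h * cos s)" unfolding e using p that by simp
    then show ?thesis using p by (simp add: zero_le_mult_iff)
  qed
  show "poly X.f (fst (curve h s)) \<le> 0" if "cos s \<le> 0"
  proof -
    have "poly X.f (fst (curve h s)) * X.\<phi>' (X.u h * cos s) \<le> 0"
      unfolding e using p that by (simp add: mult_nonneg_nonpos)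
    then show ?thesis using p by (simp add: mult_le_0_iff)
  qed
qed

lemma g_sign:
  assumes "h \<in> I"
  shows "0 \<le> sin s \<Longrightarrow> 0 \<le> poly Y.f (snd (curve h s))"
    and "sin s \<le> 0 \<Longrightarrow> poly Y.f (snd (curve h s)) \<le> 0"
proof -
  have e: "poly Y.f (snd (curve h s)) * Y.\<phi>' (X.u h * sin s) = 2 * (X.u h * sin s)"
    using Y.f_\<phi>[OF in_range_Y] by (simp add: curve_def)
  have p: "0 < Y.\<phi>' (X.u h * sin s)" "0 < X.u h"
    using Y.\<phi>'_pos[OF in_range_Y] r_pos[OF assms] by auto
  show "0 \<le> poly Y.f (snd (curve h s))" if "0 \<le> sin s"
  proof -
    have "0 \<le> poly Y.f (snd (curve h s)) * Y.\<phi>' (X.u h * sin s)" unfolding e using p that by simp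
    then show ?thesis using p by (simp add: zero_le_mult_iff)
  qed
  show "poly Y.f (snd (curve h s)) \<le> 0" if "sin s \<le> 0"
  proof -
    have "poly Y.f (snd (curve h s)) * Y.\<phi>' (X.u h * sin s) \<le> 0"
      unfolding e using p that by (simp add: mult_nonneg_nonpos)
    then show ?thesis using p by (simp add: mult_le_0_iff)
  qed
qed

text \<open>On each quarter of the oval \<open>x\<close> and \<open>y\<close> are monotone, so \<open>|x'| + |y'| \<ge> \<delta>\<close> implies that \<open>\<delta>\<close> times the
  time spent there is at most the variation of \<open>x\<close> plus that of \<open>y\<close>, which is at most \<open>4R\<close>.\<close>

lemma period_upper_bound:
  assumes h: "h \<in> I" and box: "level h \<subseteq> {-R..R} \<times> {-R..R}"
    and fast: "\<And>x y. (x, y) \<in> level h \<Longrightarrow> \<delta> \<le> \<bar>poly X.f x\<bar> + \<bar>poly Y.f y\<bar>"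
  shows "\<delta> * period h \<le> 16 * R"
proof -
  obtain \<tau> where \<tau>: "\<And>s. (\<tau> has_real_derivative W h s) (at s)" "\<tau> 0 = 0" "\<tau> (2 * pi) = period h"
    using clock[OF h] by metis
  define x where "x s = fst (curve h s)" for s
  define y where "y s = snd (curve h s)" for s
  have xy: "(x s, y s) \<in> level h" for s
    using curve_in_level[OF h] by (simp add: x_def y_def)
  have bd: "\<bar>x s\<bar> \<le> R" "\<bar>y s\<bar> \<le> R" for s
    using xy[of s] box by (auto simp: abs_le_iff)
  have arc: "\<delta> * (\<tau> b - \<tau> a) \<le> 4 * R"
    if ab: "a \<le> b" and \<sigma>: "\<bar>\<sigma>1\<bar> = 1" "\<bar>\<sigma>2\<bar> = 1"
      and g: "\<And>s. a \<le> s \<Longrightarrow> s \<le> b \<Longrightarrow> 0 \<le> \<sigma>1 * poly Y.f (y s)"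
      and f: "\<And>s. a \<le> s \<Longrightarrow> s \<le> b \<Longrightarrow> 0 \<le> \<sigma>2 * poly X.f (x s)"
    for a b \<sigma>1 \<sigma>2 :: real
  proof -
    let ?k = "\<lambda>s. \<sigma>2 * y s - \<sigma>1 * x s - \<delta> * \<tau> s"
    have "?k a \<le> ?k b"
    proof (rule DERIV_nonneg_imp_nondecreasing[OF ab])
      fix s assume s: "a \<le> s" "s \<le> b"
      have "(?k has_real_derivative (\<sigma>2 * poly X.f (x s) + \<sigma>1 * poly Y.f (y s) - \<delta>) * W h s) (at s)"
        using curve_deriv[OF h, of s] unfolding x_def y_def
        by (auto intro!: derivative_eq_intros \<tau>(1) simp: algebra_simps)
      moreover have "\<sigma>2 * poly X.f (x s) + \<sigma>1 * poly Y.f (y s) = \<bar>poly X.f (x s)\<bar> + \<bar>poly Y.f (y s)\<bar>"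
        using abs_of_nonneg[OF f[OF s]] abs_of_nonneg[OF g[OF s]] \<sigma> by (simp add: abs_mult)
      ultimately show "\<exists>d. (?k has_real_derivative d) (at s) \<and> 0 \<le> d"
        using fast[OF xy[of s]] W_pos[OF h, of s]
        by (metis diff_ge_0_iff_ge less_imp_le mult_nonneg_nonneg)
    qed
    moreover have "\<bar>\<sigma>2 * y a\<bar> \<le> R" "\<bar>\<sigma>2 * y b\<bar> \<le> R" "\<bar>\<sigma>1 * x a\<bar> \<le> R" "\<bar>\<sigma>1 * x b\<bar> \<le> R"
      using \<sigma> bd by (simp_all add: abs_mult)
    ultimately show ?thesis by (simp add: algebra_simps abs_le_iff)
  qed
  have 1: "\<delta> * (\<tau> (pi / 2) - \<tau> 0) \<le> 4 * R"
    by (rule arc[where ?\<sigma>1.0 = 1 and ?\<sigma>2.0 = 1])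
      (auto simp: x_def y_def intro!: f_sign g_sign h sin_ge_zero cos_ge_zero)
  have 2: "\<delta> * (\<tau> pi - \<tau> (pi / 2)) \<le> 4 * R"
  proof (rule arc[where ?\<sigma>1.0 = 1 and ?\<sigma>2.0 = "-1"])
    fix s assume "pi / 2 \<le> s" "s \<le> pi"
    then show "0 \<le> 1 * poly Y.f (y s)" "0 \<le> - 1 * poly X.f (x s)"
      using f_sign(2)[OF h, of s] g_sign(1)[OF h, of s] cos_ge_zero[of "s - pi"] sin_ge_zero[of s]
      by (auto simp: x_def y_def cos_diff)
  qed auto
  have 3: "\<delta> * (\<tau> (3 * pi / 2) - \<tau> pi) \<le> 4 * R"
  proof (rule arc[where ?\<sigma>1.0 = "-1" and ?\<sigma>2.0 = "-1"])
    fix s assume "pi \<le> s" "s \<le> 3 * pi / 2"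
    then show "0 \<le> - 1 * poly Y.f (y s)" "0 \<le> - 1 * poly X.f (x s)"
      using f_sign(2)[OF h, of s] g_sign(2)[OF h, of s] cos_ge_zero[of "s - pi"] sin_ge_zero[of "s - pi"]
      by (auto simp: x_def y_def cos_diff sin_diff)
  qed auto
  have 4: "\<delta> * (\<tau> (2 * pi) - \<tau> (3 * pi / 2)) \<le> 4 * R"
  proof (rule arc[where ?\<sigma>1.0 = "-1" and ?\<sigma>2.0 = 1])
    fix s assume "3 * pi / 2 \<le> s" "s \<le> 2 * pi"
    then show "0 \<le> - 1 * poly Y.f (y s)" "0 \<le> 1 * poly X.f (x s)"
      using f_sign(1)[OF h, of s] g_sign(2)[OF h, of s] cos_ge_zero[of "s - 2 * pi"] sin_ge_zero[of "s - pi"]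
      by (auto simp: x_def y_def cos_diff sin_diff)
  qed auto
  show ?thesis using 1 2 3 4 \<tau> by (simp add: algebra_simps)
qed

text \<open>During one period the orbit travels from \<open>(a, b)\<close> to its leftmost point \<open>(c, 0)\<close>, \<open>c < 0\<close>, which is
  at distance at least \<open>1\<close>. If the field is small at \<open>(a, b)\<close>, this takes long by \<open>slow_escape\<close>.\<close>

lemma period_lower_bound:
  assumes h: "h \<in> I" and ab: "(a, b) \<in> level h" "1 \<le> a \<or> 1 \<le> b"
    and box: "level h \<subseteq> {-R..R} \<times> {-R..R}" and \<Lambda>: "0 \<le> \<Lambda>"
    and lip_f: "\<And>x y. \<bar>x\<bar> \<le> R \<Longrightarrow> \<bar>y\<bar> \<le> R \<Longrightarrow> \<bar>poly X.f x - poly X.f y\<bar> \<le> \<Lambda> * \<bar>x - y\<bar>"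
    and lip_g: "\<And>x y. \<bar>x\<bar> \<le> R \<Longrightarrow> \<bar>y\<bar> \<le> R \<Longrightarrow> \<bar>poly Y.f x - poly Y.f y\<bar> \<le> \<Lambda> * \<bar>x - y\<bar>"
  shows "1 \<le> ((poly X.f a)\<^sup>2 + (poly Y.f b)\<^sup>2) * exp ((2 * \<Lambda> + 1) * period h)"
proof -
  obtain \<gamma> where \<gamma>: "is_solution vf \<gamma>" "\<And>t. \<gamma> (t + period h) = \<gamma> t" "range \<gamma> = level h" "0 < period h"
    using orbit_through[OF h] by metis
  obtain t1 where t1: "\<gamma> t1 = (a, b)" using ab(1) \<gamma>(3) by (metis rangeE)
  define \<delta> where "\<delta> t = \<gamma> (t + t1)" for t
  have sol: "is_solution (separable_field X.f Y.f) \<delta>"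
    unfolding \<delta>_def by (rule solution_shift[OF \<gamma>(1)[unfolded vf_def]])
  have per: "\<delta> (t + period h) = \<delta> t" for t
    using \<gamma>(2)[of "t + t1"] by (simp add: \<delta>_def algebra_simps)
  have lev: "\<delta> t \<in> level h" for t using \<gamma>(3) by (auto simp: \<delta>_def)
  have bd: "\<bar>fst (\<delta> t)\<bar> \<le> R" "\<bar>snd (\<delta> t)\<bar> \<le> R" for t
    using lev[of t] box by (auto simp: abs_le_iff)
  obtain c where c: "c < 0" "(c, 0) \<in> level h" using leftmost_point[OF h] .
  then obtain t2 where "\<gamma> t2 = (c, 0)" using \<gamma>(3) by (metis rangeE)
  then have "\<delta> (t2 - t1) = (c, 0)" by (simp add: \<delta>_def)
  then obtain t where t: "0 \<le> t" "t \<le> period h" "\<delta> t = (c, 0)"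
    using periodic_representative[of "period h" \<delta> "t2 - t1", OF \<gamma>(4) per] by metis
  have "1 \<le> (c - a)\<^sup>2 + (0 - b)\<^sup>2"
    using ab(2)
  proof
    assume "1 \<le> a"
    then have "1\<^sup>2 \<le> (a - c)\<^sup>2" using c by (intro power_mono) auto
    then have "1 \<le> (c - a)\<^sup>2" by (simp add: power2_commute)
    then show ?thesis by (simp add: add_increasing2)
  next
    assume "1 \<le> b"
    then have "1\<^sup>2 \<le> b\<^sup>2" by (intro power_mono) auto
    then show ?thesis by (simp add: add_increasing)
  qed
  also have "\<dots> \<le> ((poly X.f a)\<^sup>2 + (poly Y.f b)\<^sup>2) * exp ((2 * \<Lambda> + 1) * t)"
    using slow_escape[OF sol _ t(1) bd lip_f lip_g \<Lambda>, of a b] t(3) t1 by (simp add: \<delta>_def)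
  also have "\<dots> \<le> ((poly X.f a)\<^sup>2 + (poly Y.f b)\<^sup>2) * exp ((2 * \<Lambda> + 1) * period h)"
    using t \<Lambda> by (intro mult_left_mono) (auto intro!: mult_left_mono)
  finally show ?thesis .
qed

end

section \<open>Counting local extrema\<close>

lemma interior_extremum:
  fixes T :: "real \<Rightarrow> real"
  assumes cont: "continuous_on {a..b} T" and x: "a < x" "x < b" and gt: "T a < T x" "T b < T x"
  obtains y where "a < y" "y < b" "T x \<le> T y" "\<And>z. a < z \<Longrightarrow> z < b \<Longrightarrow> T z \<le> T y"
proof -
  have "\<exists>y\<in>{a..b}. \<forall>z\<in>{a..b}. T z \<le> T y"
    using x cont by (intro continuous_attains_sup) auto
  then obtain y where y: "a \<le> y" "y \<le> b" "\<And>z. a \<le> z \<Longrightarrow> z \<le> b \<Longrightarrow> T z \<le> T y" by auto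
  have "T x \<le> T y" using y(3) x by auto
  moreover from this have "y \<noteq> a" "y \<noteq> b" using gt by auto
  ultimately show ?thesis using y by (intro that[of y]) auto
qed

text \<open>Around each inner \<open>s i\<close> there is an extremum between its two neighbours. These intervals overlap, but
  maxima have values above \<open>M\<close> and minima below, and intervals of equal parity are disjoint, so the
  extrema are distinct.\<close>

lemma alternating_values_critical_parameters:
  fixes T :: "real \<Rightarrow> real" and s :: "nat \<Rightarrow> real"
  assumes I: "is_interval I" and cont: "continuous_on I T"
    and s: "\<And>i. i \<le> N \<Longrightarrow> s i \<in> I" "\<And>i. i < N \<Longrightarrow> s i < s (Suc i)"
    and low: "\<And>i. i \<le> N \<Longrightarrow> even i \<Longrightarrow> T (s i) < M"
    and high: "\<And>i. i \<le> N \<Longrightarrow> odd i \<Longrightarrow> M < T (s i)"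
  shows "infinite (critical_parameters T I) \<or> N - 1 \<le> card (critical_parameters T I)"
proof (cases "2 \<le> N")
  case N: True
  have smono: "s i \<le> s j" if "i \<le> j" "j \<le> N" for i j
    using that
  proof (induction j rule: dec_induct)
    case (step n)
    then show ?case using s(2)[of n] by simp
  qed simp
  have sub: "{s i..s j} \<subseteq> I" if "i \<le> N" "j \<le> N" for i j
    using I s(1) that by (meson atLeastAtMost_iff is_interval_1 subsetI)
  have T01: "T (s 0) < T (s 1)" "T (s 2) < T (s 1)"
    using low[of 0] high[of 1] low[of 2] N by auto
  have "s 0 < s 1" "s 1 < s 2" using s(2)[of 0] s(2)[of 1] N by (auto simp: numeral_2_eq_2)
  then have "\<not> mono_on I T" "\<not> antimono_on I T"
    using T01 s(1)[of 0] s(1)[of 1] s(1)[of 2] N monotone_onD[of I "(\<le>)" "(\<le>)" T "s 1" "s 2"]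
      monotone_onD[of I "(\<le>)" "(\<ge>)" T "s 0" "s 1"] by auto
  then have crit: "critical_parameters T I = {h \<in> I. (\<forall>\<^sub>F h' in at h within I. T h' \<le> T h) \<or>
                   (\<forall>\<^sub>F h' in at h within I. T h \<le> T h')}"
    by (simp add: critical_parameters_def)
  have near: "\<forall>\<^sub>F h' in at y within I. P h'"
    if "a < y" "y < b" "\<And>z. a < z \<Longrightarrow> z < b \<Longrightarrow> P z" for a b y P
    unfolding eventually_at_topological using that by (intro exI[of _ "{a<..<b}"]) auto
  have ex: "\<exists>y. s i < y \<and> y < s (i + 2) \<and> y \<in> critical_parameters T I \<and>
      (if even i then M < T y else T y < M)" if i: "i + 2 \<le> N" for i
  proof -
    have ord: "s i < s (Suc i)" "s (Suc i) < s (i + 2)"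
      using i s(2)[of i] s(2)[of "Suc i"] by auto
    have c: "continuous_on {s i..s (i + 2)} T"
      using cont by (rule continuous_on_subset) (use sub i in auto)
    have inI: "y \<in> I" if "s i < y" "y < s (i + 2)" for y using sub[of i "i + 2"] i that by auto
    show ?thesis
    proof (cases "even i")
      case True
      then have v: "T (s i) < M" "M < T (s (Suc i))" "T (s (i + 2)) < M"
        using low[of i] high[of "Suc i"] low[of "i + 2"] i by auto
      have "T (s i) < T (s (Suc i))" "T (s (i + 2)) < T (s (Suc i))" using v by linarith+
      from interior_extremum[OF c ord this]
      obtain y where y: "s i < y" "y < s (i + 2)" "T (s (Suc i)) \<le> T y"
          "\<And>z. s i < z \<Longrightarrow> z < s (i + 2) \<Longrightarrow> T z \<le> T y"
        by blast
      then have "y \<in> critical_parameters T I"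
        unfolding crit using inI near[of "s i" y "s (i + 2)" "\<lambda>z. T z \<le> T y"] by blast
      then show ?thesis using y v True by auto
    next
      case False
      then have v: "M < T (s i)" "T (s (Suc i)) < M" "M < T (s (i + 2))"
        using high[of i] low[of "Suc i"] high[of "i + 2"] i by auto
      have c': "continuous_on {s i..s (i + 2)} (\<lambda>z. - T z)" by (intro continuous_on_minus c)
      have "- T (s i) < - T (s (Suc i))" "- T (s (i + 2)) < - T (s (Suc i))" using v by linarith+
      from interior_extremum[OF c' ord this]
      obtain y where y: "s i < y" "y < s (i + 2)" "T y \<le> T (s (Suc i))"
          "\<And>z. s i < z \<Longrightarrow> z < s (i + 2) \<Longrightarrow> T y \<le> T z"
        by (auto simp: neg_le_iff_le)
      then have "y \<in> critical_parameters T I"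
        unfolding crit using inI near[of "s i" y "s (i + 2)" "\<lambda>z. T y \<le> T z"] by blast
      then show ?thesis using y v False by auto
    qed
  qed
  then obtain y where y: "\<And>i. i + 2 \<le> N \<Longrightarrow> s i < y i" "\<And>i. i + 2 \<le> N \<Longrightarrow> y i < s (i + 2)"
      "\<And>i. i + 2 \<le> N \<Longrightarrow> y i \<in> critical_parameters T I"
      "\<And>i. i + 2 \<le> N \<Longrightarrow> (if even i then M < T (y i) else T (y i) < M)"
    by metis
  have less: "y i \<noteq> y j" if ij: "i < j" "j + 2 \<le> N" for i j
  proof (cases "even i = even j")
    case False
    then show ?thesis using y(4)[of i] y(4)[of j] ij by (auto split: if_splits)
  next
    case True
    then have "j \<noteq> Suc i" by auto
    then have "i + 2 \<le> j" using ij by simp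
    then have "s (i + 2) \<le> s j" using ij by (intro smono) auto
    then show ?thesis using y(2)[of i] y(1)[of j] ij by auto
  qed
  have "inj_on y {..<N - 1}"
  proof (rule inj_onI, rule ccontr)
    fix i j assume "i \<in> {..<N - 1}" "j \<in> {..<N - 1}" "y i = y j" "i \<noteq> j"
    moreover from this have "i + 2 \<le> N" "j + 2 \<le> N" by auto
    ultimately show False using less[of i j] less[of j i] by (metis linorder_neqE_nat)
  qed
  moreover have "y ` {..<N - 1} \<subseteq> critical_parameters T I" using y(3) by auto
  ultimately show ?thesis using card_inj_on_le[of y "{..<N - 1}"] by fastforce
qed simp

lemma critical_parameters_cong:
  assumes "\<And>h. h \<in> I \<Longrightarrow> T h = T' h"
  shows "critical_parameters T I = critical_parameters T' I"
proof -
  have ev: "(\<forall>\<^sub>F h' in at h within I. P (T h') (T h)) \<longleftrightarrow> (\<forall>\<^sub>F h' in at h within I. P (T' h') (T' h))"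
    if "h \<in> I" for h and P :: "real \<Rightarrow> real \<Rightarrow> bool"
    unfolding eventually_at_filter using assms that by (intro arg_cong[where f = "\<lambda>Q. eventually Q (nhds h)"] ext) auto
  have "monotone_on I (\<le>) r T = monotone_on I (\<le>) r T'" for r :: "real \<Rightarrow> real \<Rightarrow> bool"
    using assms by (auto simp: monotone_on_def)
  moreover note ev[of _ "(\<le>)"] ev[of _ "\<lambda>a b. b \<le> a"]
  ultimately show ?thesis unfolding critical_parameters_def by auto
qed

lemma sorted_enumeration:
  fixes \<Sigma> :: "real set"
  assumes "finite \<Sigma>"
  obtains t where "t ` {..<card \<Sigma>} = \<Sigma>" "\<And>i j. i < j \<Longrightarrow> j < card \<Sigma> \<Longrightarrow> t i < t j"
proof (rule that[of "\<lambda>i. sorted_list_of_set \<Sigma> ! i"])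
  have l: "length (sorted_list_of_set \<Sigma>) = card \<Sigma>" by simp
  show "(!) (sorted_list_of_set \<Sigma>) ` {..<card \<Sigma>} = \<Sigma>"
    using assms nth_image[of "card \<Sigma>" "sorted_list_of_set \<Sigma>"] l by (simp add: atLeast0LessThan[symmetric] lessThan_atLeast0)
  show "sorted_list_of_set \<Sigma> ! i < sorted_list_of_set \<Sigma> ! j" if "i < j" "j < card \<Sigma>" for i j
    using sorted_wrt_nth_less[OF strict_sorted_list_of_set that(1)] that l by simp
qed

section \<open>Polynomials with nearly double critical points\<close>

text \<open>The coefficient of \<open>x\<^sup>i\<close> in \<open>K\<close> has to be that of \<open>p\<close> divided by \<open>i + 2\<close>. Induction on \<open>p\<close> shifts the
  exponents, hence the general constant \<open>c\<close> in place of \<open>2\<close>.\<close>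

lemma halving_equation_solvable:
  fixes p :: "real poly"
  obtains K where "smult 2 K + pCons 0 (pderiv K) = p"
proof -
  have "\<exists>K. smult c K + pCons 0 (pderiv K) = p" if "0 < c" for c :: real
    using that
  proof (induction p arbitrary: c)
    case 0
    show ?case by (rule exI[of _ 0]) simp
  next
    case (pCons a p)
    from pCons.IH[of "c + 1"] pCons.prems
    obtain K where K: "smult (c + 1) K + pCons 0 (pderiv K) = p" by auto
    have "smult c (pCons (a / c) K) + pCons 0 (pderiv (pCons (a / c) K)) = pCons a p"
      using pCons.prems by (simp add: pderiv_pCons smult_add_left algebra_simps flip: K)
    then show ?case by blast
  qed
  from this[of 2] show ?thesis using that by auto
qed

definition square_comb :: "nat \<Rightarrow> real poly" where
  "square_comb m = (\<Prod>i=1..m. [:- real i, 1:]\<^sup>2)"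

lemma poly_square_comb: "poly (square_comb m) x = (\<Prod>i=1..m. (x - real i)\<^sup>2)"
  by (simp add: square_comb_def poly_prod poly_power)

lemma square_comb_nonneg: "0 \<le> poly (square_comb m) x"
  by (simp add: poly_square_comb prod_nonneg)

lemma square_comb_zero_iff: "poly (square_comb m) x = 0 \<longleftrightarrow> (\<exists>i\<in>{1..m}. x = real i)"
  by (auto simp: poly_square_comb)

lemma square_comb_ge_1:
  assumes "x \<le> 0 \<or> real m + 1 \<le> x"
  shows "1 \<le> poly (square_comb m) x"
  unfolding poly_square_comb
proof (rule prod_ge_1)
  fix i assume "i \<in> {1..m}"
  then have "1 \<le> \<bar>x - real i\<bar>" using assms by auto
  then show "1 \<le> (x - real i)\<^sup>2" by (metis abs_le_square_iff abs_one one_power2)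
qed

lemma degree_square_comb: "degree (square_comb m) = 2 * m"
proof -
  have "degree (square_comb m) = (\<Sum>i=1..m. degree ([:- real i, 1:]\<^sup>2))"
    unfolding square_comb_def by (rule degree_prod_eq_sum_degree) auto
  also have "\<dots> = (\<Sum>i=1..m. 2)" by (intro sum.cong) (auto simp: degree_power_eq)
  finally show ?thesis by simp
qed

text \<open>The derivative \<open>x w(x) (\<Prod>\<^sub>i (x - i)\<^sup>2 + \<epsilon>)\<close> of the potential is affine in \<open>\<epsilon>\<close>. So the potential is
  \<open>F0 + \<epsilon> F1\<close> with \<open>F0\<close> coming from \<open>Kb\<close> and \<open>F1\<close> from \<open>Kw\<close>. The zero \<open>m + 2\<close> of the second choice of \<open>w\<close>
  leaves room for the point \<open>m + 1\<close>, at which \<open>F0\<close> exceeds its values at the teeth \<open>1, \<dots>, m\<close>.\<close>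

locale comb =
  fixes m :: nat and S :: "real set" and w Kb Kw :: "real poly"
  assumes S_w: "S = UNIV \<and> w = 1 \<or> S = {..<real m + 2} \<and> w = [:real m + 2, - 1:]"
    and Kb: "smult 2 Kb + pCons 0 (pderiv Kb) = w * square_comb m"
    and Kw: "smult 2 Kw + pCons 0 (pderiv Kw) = w"
begin

definition F0 :: "real \<Rightarrow> real" where "F0 x = x\<^sup>2 * poly Kb x"
definition F1 :: "real \<Rightarrow> real" where "F1 x = x\<^sup>2 * poly Kw x"
definition p :: "real \<Rightarrow> real poly" where "p \<epsilon> = w * (square_comb m + [:\<epsilon>:])"
definition K :: "real \<Rightarrow> real poly" where "K \<epsilon> = Kb + smult \<epsilon> Kw"

lemma w_pos: "x \<in> S \<Longrightarrow> 0 < poly w x"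
  using S_w by auto

lemma S_props: "open S" "is_interval S" "x \<le> real m + 1 \<Longrightarrow> x \<in> S"
  using S_w by (auto simp: is_interval_1)

lemma K_eq: "smult 2 (K \<epsilon>) + pCons 0 (pderiv (K \<epsilon>)) = p \<epsilon>"
proof -
  have "smult 2 (K \<epsilon>) + pCons 0 (pderiv (K \<epsilon>)) =
      (smult 2 Kb + pCons 0 (pderiv Kb)) + smult \<epsilon> (smult 2 Kw + pCons 0 (pderiv Kw))"
    by (simp add: K_def pderiv_add pderiv_smult smult_add_right algebra_simps)
  also have "\<dots> = w * square_comb m + smult \<epsilon> w" unfolding Kb Kw ..
  finally show ?thesis by (simp add: p_def algebra_simps)
qed

lemma p_pos: "0 < \<epsilon> \<Longrightarrow> x \<in> S \<Longrightarrow> 0 < poly (p \<epsilon>) x"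
  using w_pos[of x] square_comb_nonneg[of m x] by (simp add: p_def add_nonneg_pos)

lemma well: "0 < \<epsilon> \<Longrightarrow> potential_well S (p \<epsilon>) (K \<epsilon>)"
  using S_props p_pos K_eq by unfold_locales auto

lemma well_w: "potential_well S w Kw"
  using S_props w_pos Kw by unfold_locales auto

lemma F_split: "x\<^sup>2 * poly (K \<epsilon>) x = F0 x + \<epsilon> * F1 x"
  by (simp add: K_def F0_def F1_def algebra_simps)

lemma F1_nonneg: "x \<in> S \<Longrightarrow> 0 \<le> F1 x"
  using potential_well.F_nonneg[OF well_w] by (simp add: potential_well.F_def[OF well_w] F1_def)

lemma F0_deriv: "(F0 has_real_derivative x * poly w x * poly (square_comb m) x) (at x)"
proof -
  have "2 * poly Kb x + x * poly (pderiv Kb) x = poly w x * poly (square_comb m) x"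
    using arg_cong[OF Kb, of "\<lambda>q. poly q x"] by simp
  then have *: "x * poly w x * poly (square_comb m) x = x * (2 * poly Kb x + x * poly (pderiv Kb) x)"
    by simp
  show ?thesis
    unfolding F0_def * by (auto intro!: derivative_eq_intros simp: algebra_simps power2_eq_square)
qed

lemma F0_cont: "continuous_on A F0"
  and F1_cont: "continuous_on A F1"
  unfolding F0_def F1_def by (intro continuous_intros)+

lemma F0_0 [simp]: "F0 0 = 0" and F1_0 [simp]: "F1 0 = 0"
  by (simp_all add: F0_def F1_def)

lemma F0_Suc:
  assumes "i \<le> m"
  shows "F0 (real i) < F0 (real (Suc i))"
proof (rule DERIV_pos_imp_increasing_open[OF _ _ F0_cont])
  fix x assume x: "real i < x" "x < real (Suc i)"
  have "poly (square_comb m) x \<noteq> 0"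
  proof
    assume "poly (square_comb m) x = 0"
    then obtain j where "x = real j" by (auto simp: square_comb_zero_iff)
    then show False using x by simp
  qed
  then have "0 < poly (square_comb m) x" using square_comb_nonneg[of m x] by simp
  moreover have "0 < x" "x \<in> S" using x assms by (auto intro!: S_props)
  ultimately show "\<exists>d. (F0 has_real_derivative d) (at x) \<and> 0 < d"
    using w_pos[of x] by (intro exI[of _ "x * poly w x * poly (square_comb m) x"] conjI F0_deriv) simp
qed simp

lemma F0_less:
  assumes "i < j" "j \<le> Suc m"
  shows "F0 (real i) < F0 (real j)"
  using assms
proof (induction j)
  case (Suc j)
  then have "F0 (real j) < F0 (real (Suc j))" by (intro F0_Suc) simp
  then show ?case using Suc by (cases "i = j") auto
qed simp

text \<open>The linear bound comes from \<open>|F0'| \<ge> 1\<close> for \<open>x \<le> - 1\<close> and, if \<open>S\<close> is the whole line, for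
  \<open>x \<ge> m + 1\<close>. It confines the levels of bounded energy to a box, uniformly in \<open>\<epsilon>\<close>.\<close>

lemma F0_growth:
  assumes "x \<in> S"
  shows "0 \<le> F0 x" and "\<bar>x\<bar> - (real m + 2) \<le> F0 x"
proof -
  have mono: "F0 a \<le> F0 b" if "0 \<le> a" "a \<le> b" "b \<in> S" for a b
    using that(2)
  proof (rule DERIV_nonneg_imp_nondecreasing)
    fix z assume "a \<le> z" "z \<le> b"
    moreover from this have "z \<in> S" using that S_w by auto
    ultimately show "\<exists>d. (F0 has_real_derivative d) (at z) \<and> 0 \<le> d"
      using that w_pos[of z] square_comb_nonneg[of m z]
      by (intro exI[of _ "z * poly w z * poly (square_comb m) z"] conjI F0_deriv) auto
  qed
  have neg: "- x \<le> F0 x + 1 \<and> 0 \<le> F0 x" if x: "x \<le> 0" for x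
  proof -
    have le0: "F0 b \<le> F0 a" if "a \<le> b" "b \<le> 0" for a b
      using that(1)
    proof (rule DERIV_nonpos_imp_nonincreasing)
      fix z assume "a \<le> z" "z \<le> b"
      moreover from this have "z \<in> S" using that by (intro S_props) auto
      ultimately show "\<exists>d. (F0 has_real_derivative d) (at z) \<and> d \<le> 0"
        using that w_pos[of z] square_comb_nonneg[of m z]
        by (intro exI[of _ "z * poly w z * poly (square_comb m) z"] conjI F0_deriv)
          (auto simp: mult_le_0_iff)
    qed
    have "F0 (-1) + - 1 \<le> F0 x + x" if "x \<le> - 1"
      using that
    proof (rule DERIV_nonpos_imp_nonincreasing)
      fix z assume z: "x \<le> z" "z \<le> - 1"
      have "1 \<le> poly w z" using S_w z by auto
      moreover have "1 \<le> poly (square_comb m) z" using z by (intro square_comb_ge_1) auto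
      ultimately have "1 \<le> poly w z * poly (square_comb m) z" by (metis mult_mono' mult_1 zero_le_one)
      then have "z * (poly w z * poly (square_comb m) z) \<le> z * 1"
        using z by (intro mult_left_mono_neg) auto
      then have "z * poly w z * poly (square_comb m) z + 1 \<le> 0"
        using z unfolding mult.assoc by linarith
      moreover have "((\<lambda>x. F0 x + x) has_real_derivative z * poly w z * poly (square_comb m) z + 1) (at z)"
        by (intro DERIV_add F0_deriv DERIV_ident)
      ultimately show "\<exists>d. ((\<lambda>x. F0 x + x) has_real_derivative d) (at z) \<and> d \<le> 0" by blast
    qed
    moreover have "0 \<le> F0 x" "0 \<le> F0 (-1)" using le0[of x 0] le0[of "-1" 0] x by auto
    ultimately show ?thesis by linarith
  qed
  have pos: "x - (real m + 2) \<le> F0 x \<and> 0 \<le> F0 x" if x: "0 \<le> x" "x \<in> S" for x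
  proof -
    have nn: "0 \<le> F0 x" using mono[of 0 x] x by simp
    show ?thesis
    proof (cases "S = UNIV \<and> real m + 1 \<le> x")
      case True
      then have "real m + 1 \<le> x" by simp
      then have "F0 (real m + 1) - (real m + 1) \<le> F0 x - x"
      proof (rule DERIV_nonneg_imp_nondecreasing[where f = "\<lambda>x. F0 x - x"])
        fix z assume z: "real m + 1 \<le> z" "z \<le> x"
        have "1 \<le> poly (square_comb m) z" using z by (intro square_comb_ge_1) auto
        then have "1 * 1 \<le> z * poly (square_comb m) z" using z by (intro mult_mono) auto
        moreover have "poly w z = 1" using True S_w by auto
        ultimately have "0 \<le> z * poly w z * poly (square_comb m) z - 1" by simp
        moreover have "((\<lambda>x. F0 x - x) has_real_derivative z * poly w z * poly (square_comb m) z - 1) (at z)"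
          by (intro DERIV_diff F0_deriv DERIV_ident)
        ultimately show "\<exists>d. ((\<lambda>x. F0 x - x) has_real_derivative d) (at z) \<and> 0 \<le> d" by blast
      qed
      moreover have "0 \<le> F0 (real m + 1)" using mono[of 0 "real m + 1"] True by simp
      ultimately show ?thesis using nn by simp
    next
      case False
      then have "x \<le> real m + 2" using x S_w by auto
      then show ?thesis using nn by simp
    qed
  qed
  show "0 \<le> F0 x" "\<bar>x\<bar> - (real m + 2) \<le> F0 x"
    using neg[of x] pos[of x] assms by (cases "x \<le> 0"; force)+
qed

lemma F_growth:
  assumes "0 \<le> \<epsilon>" "x \<in> S"
  shows "0 \<le> F0 x + \<epsilon> * F1 x" and "\<bar>x\<bar> - (real m + 2) \<le> F0 x + \<epsilon> * F1 x"
  using F0_growth[OF assms(2)] F1_nonneg[OF assms(2)] assms(1) by (auto simp: add_increasing2)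

lemma p_zero_iff:
  assumes "0 \<le> \<epsilon>" "x \<in> S"
  shows "x * poly (p \<epsilon>) x = 0 \<longleftrightarrow> x = 0 \<or> \<epsilon> = 0 \<and> (\<exists>i\<in>{1..m}. x = real i)"
  using w_pos[OF assms(2)] square_comb_nonneg[of m x] assms(1)
  by (auto simp: p_def add_nonneg_eq_0_iff square_comb_zero_iff)

lemma p_at_tooth: "i \<le> m \<Longrightarrow> real i * poly (p \<epsilon>) (real i) = \<epsilon> * (real i * poly w (real i))"
proof (cases "i = 0")
  case False
  moreover assume "i \<le> m"
  ultimately have "poly (square_comb m) (real i) = 0" by (auto simp: square_comb_zero_iff)
  then show ?thesis by (simp add: p_def)
qed simp

lemma degree_p: "0 < \<epsilon> \<Longrightarrow> degree (pCons 0 (p \<epsilon>)) = 2 * m + 1 + (if S = UNIV then 0 else 1)"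
  and p_nonzero: "0 < \<epsilon> \<Longrightarrow> p \<epsilon> \<noteq> 0"
proof -
  assume \<epsilon>: "0 < \<epsilon>"
  let ?q = "square_comb m + [:\<epsilon>:]"
  have "0 < poly ?q 0" using square_comb_nonneg[of m 0] \<epsilon> by (simp add: add_nonneg_pos)
  then have q0: "?q \<noteq> 0" by force
  have dq: "degree ?q = 2 * m"
  proof (cases "m = 0")
    case True
    then show ?thesis by (simp add: square_comb_def one_pCons)
  next
    case False
    then have "degree [:\<epsilon>:] < degree (square_comb m)" by (simp add: degree_square_comb)
    then show ?thesis by (simp add: degree_add_eq_left degree_square_comb)
  qed
  have w: "w \<noteq> 0" "degree w = (if S = UNIV then 0 else 1)"
    using S_w by (auto simp: lessThan_eq_iff)
  show "p \<epsilon> \<noteq> 0" using q0 w(1) by (simp add: p_def)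
  then show "degree (pCons 0 (p \<epsilon>)) = 2 * m + 1 + (if S = UNIV then 0 else 1)"
    using dq w q0 by (simp add: p_def degree_mult_eq)
qed

end

section \<open>Oscillation of the period for small perturbations\<close>

text \<open>The scaling factor \<open>\<kappa>\<close> of the second potential serves to separate the energies of the grid points.\<close>

locale comb_pair = X: comb m S w Kb Kw + Y: comb m UNIV 1 Lb Lw
  for m S w Kb Kw Lb Lw +
  fixes \<kappa> :: real
  assumes \<kappa>_pos: "0 < \<kappa>"
begin

definition q :: "real \<Rightarrow> real poly" where "q \<epsilon> = smult \<kappa> (Y.p \<epsilon>)"
definition L :: "real \<Rightarrow> real poly" where "L \<epsilon> = smult \<kappa> (Y.K \<epsilon>)"
definition FX :: "real \<Rightarrow> real \<Rightarrow> real" where "FX \<epsilon> x = X.F0 x + \<epsilon> * X.F1 x"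
definition GY :: "real \<Rightarrow> real \<Rightarrow> real" where "GY \<epsilon> y = \<kappa> * (Y.F0 y + \<epsilon> * Y.F1 y)"
definition E :: "real \<Rightarrow> nat \<times> nat \<Rightarrow> real" where
  "E \<epsilon> ij = FX \<epsilon> (real (fst ij)) + GY \<epsilon> (real (snd ij))"
definition J :: "real set" where "J = {h \<in> S. 0 < h}"
definition T :: "real \<Rightarrow> real \<Rightarrow> real" where
  "T \<epsilon> = separable_center.period S (X.p \<epsilon>) (X.K \<epsilon>) (q \<epsilon>) (L \<epsilon>)"

text \<open>The half side of a box that contains all points of energy at most \<open>e\<close>.\<close>

definition R :: "real \<Rightarrow> real" where "R e = real m + 2 + e + e / \<kappa>"

lemma well_Y: "0 < \<epsilon> \<Longrightarrow> potential_well UNIV (q \<epsilon>) (L \<epsilon>)"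
proof unfold_locales
  assume "0 < \<epsilon>"
  then show "0 < poly (q \<epsilon>) x" for x using Y.p_pos[of \<epsilon> x] \<kappa>_pos by (simp add: q_def)
  show "smult 2 (L \<epsilon>) + pCons 0 (pderiv (L \<epsilon>)) = q \<epsilon>"
    using arg_cong[OF Y.K_eq[of \<epsilon>], of "smult \<kappa>"]
    by (simp add: L_def q_def pderiv_smult smult_add_right mult.commute)
qed (auto simp: is_interval_1)

lemma FX_eq: "0 < \<epsilon> \<Longrightarrow> potential_well.F (X.K \<epsilon>) x = FX \<epsilon> x"
  using X.F_split by (simp add: potential_well.F_def[OF X.well] FX_def)

lemma GY_eq:
  assumes "0 < \<epsilon>"
  shows "potential_well.F (L \<epsilon>) y = GY \<epsilon> y"
proof -
  have "potential_well.F (L \<epsilon>) y = \<kappa> * (y\<^sup>2 * poly (Y.K \<epsilon>) y)"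
    unfolding potential_well.F_def[OF well_Y[OF assms]] by (simp add: L_def)
  then show ?thesis unfolding Y.F_split GY_def .
qed

lemma fX_eq: "0 < \<epsilon> \<Longrightarrow> potential_well.f (X.p \<epsilon>) = pCons 0 (X.p \<epsilon>)"
  and gY_eq: "0 < \<epsilon> \<Longrightarrow> potential_well.f (q \<epsilon>) = pCons 0 (q \<epsilon>)"
  by (simp_all add: potential_well.f_def[OF X.well] potential_well.f_def[OF well_Y])

lemma FX_bounds:
  assumes "0 \<le> \<epsilon>" "x \<in> S"
  shows "0 \<le> FX \<epsilon> x" "\<bar>x\<bar> - (real m + 2) \<le> FX \<epsilon> x"
  using X.F_growth[OF assms] by (simp_all add: FX_def)

lemma GY_bounds:
  assumes "0 \<le> \<epsilon>"
  shows "0 \<le> GY \<epsilon> y" "\<kappa> * (\<bar>y\<bar> - (real m + 2)) \<le> GY \<epsilon> y"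
  using Y.F_growth[OF assms, of y] \<kappa>_pos by (simp_all add: GY_def mult_left_mono)

lemma separable:
  assumes \<epsilon>: "0 < \<epsilon>"
  shows "separable_center S (X.p \<epsilon>) (X.K \<epsilon>) (q \<epsilon>) (L \<epsilon>)"
proof -
  interpret XX: potential_well S "X.p \<epsilon>" "X.K \<epsilon>" by (rule X.well[OF \<epsilon>])
  interpret YY: potential_well UNIV "q \<epsilon>" "L \<epsilon>" by (rule well_Y[OF \<epsilon>])
  have big: "e \<le> GY \<epsilon> y" if "\<bar>y\<bar> = \<bar>e\<bar> / \<kappa> + real m + 2" for e y
    using GY_bounds(2)[of \<epsilon> y] \<epsilon> \<kappa>_pos that by (simp add: distrib_left)
  show ?thesis
  proof unfold_locales
    show "S = UNIV \<and> (\<forall>e. \<exists>h>0. e < XX.F h) \<or> (\<exists>c>0. S = {..<c} \<and> (\<forall>x\<ge>c. poly (X.p \<epsilon>) x \<le> 0))"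
      using X.S_w
    proof (elim disjE conjE)
      assume S: "S = UNIV"
      have "\<exists>h>0. e < XX.F h" for e
        using FX_bounds(2)[of \<epsilon> "\<bar>e\<bar> + real m + 3"] \<epsilon> S
        by (intro exI[of _ "\<bar>e\<bar> + real m + 3"]) (auto simp: FX_eq[OF \<epsilon>])
      then show ?thesis using S by simp
    next
      assume S: "S = {..<real m + 2}" and w: "w = [:real m + 2, - 1:]"
      have "poly (X.p \<epsilon>) x \<le> 0" if "real m + 2 \<le> x" for x
      proof -
        have "poly w x \<le> 0" using that by (simp add: w)
        then show ?thesis unfolding X.p_def using \<epsilon> square_comb_nonneg[of m x]
          by (simp add: mult_nonpos_nonneg)
      qed
      then show ?thesis using S by (intro disjI2 exI[of _ "real m + 2"]) auto
    qed
    show "\<exists>x\<in>S. x < 0 \<and> e \<le> XX.F x" for e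
      using FX_bounds(2)[of \<epsilon> "- (\<bar>e\<bar> + real m + 2)"] \<epsilon> X.S_props(3)[of "- (\<bar>e\<bar> + real m + 2)"]
      by (intro bexI[of _ "- (\<bar>e\<bar> + real m + 2)"]) (auto simp: FX_eq[OF \<epsilon>])
    fix e
    define y where "y = \<bar>e\<bar> / \<kappa> + real m + 2"
    have "0 \<le> \<bar>e\<bar> / \<kappa>" using \<kappa>_pos by simp
    then have y: "0 < y" by (simp add: y_def)
    then have abs: "\<bar>y\<bar> = \<bar>e\<bar> / \<kappa> + real m + 2" "\<bar>- y\<bar> = \<bar>e\<bar> / \<kappa> + real m + 2"
      by (simp_all add: y_def)
    show "\<exists>y<0. e \<le> YY.F y"
      unfolding GY_eq[OF \<epsilon>] using big[OF abs(2)] y by (intro exI[of _ "- y"]) simp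
    show "\<exists>y>0. e \<le> YY.F y"
      unfolding GY_eq[OF \<epsilon>] using big[OF abs(1)] y by (intro exI[of _ y]) simp
  qed
qed

lemma J_eq:
  fixes \<epsilon> :: real
  assumes "0 < \<epsilon>"
  shows "separable_center.I S = J"
  unfolding J_def by (rule separable_center.I_def[OF separable[OF assms]])

lemma mem_level_iff:
  "0 < \<epsilon> \<Longrightarrow> (x, y) \<in> separable_center.level S (X.K \<epsilon>) (L \<epsilon>) h \<longleftrightarrow> x \<in> S \<and> FX \<epsilon> x + GY \<epsilon> y = FX \<epsilon> h"
  by (simp add: separable_center.level_def[OF separable] FX_eq GY_eq)

lemma energy_box:
  assumes "0 \<le> \<epsilon>" "x \<in> S" "FX \<epsilon> x + GY \<epsilon> y \<le> e"
  shows "\<bar>x\<bar> \<le> R e" "\<bar>y\<bar> \<le> R e"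
proof -
  have 1: "0 \<le> FX \<epsilon> x" "\<bar>x\<bar> - (real m + 2) \<le> FX \<epsilon> x" "0 \<le> GY \<epsilon> y"
    "\<kappa> * (\<bar>y\<bar> - (real m + 2)) \<le> GY \<epsilon> y"
    using FX_bounds[OF assms(1,2)] GY_bounds[OF assms(1)] by auto
  then have "0 \<le> e" using assms(3) by linarith
  then have e: "0 \<le> e" "0 \<le> e / \<kappa>" using \<kappa>_pos by auto
  have "\<kappa> * (\<bar>y\<bar> - (real m + 2)) \<le> e" using 1 assms(3) by linarith
  then have "\<bar>y\<bar> - (real m + 2) \<le> e / \<kappa>" using \<kappa>_pos by (simp add: pos_le_divide_eq mult.commute)
  then show "\<bar>x\<bar> \<le> R e" "\<bar>y\<bar> \<le> R e" using 1 assms(3) e unfolding R_def by linarith+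
qed

lemma level_box:
  assumes "0 < \<epsilon>" "FX \<epsilon> h \<le> e"
  shows "separable_center.level S (X.K \<epsilon>) (L \<epsilon>) h \<subseteq> {- R e..R e} \<times> {- R e..R e}"
proof
  fix z assume z: "z \<in> separable_center.level S (X.K \<epsilon>) (L \<epsilon>) h"
  obtain x y where "z = (x, y)" by (cases z)
  then show "z \<in> {- R e..R e} \<times> {- R e..R e}"
    using energy_box[of \<epsilon> x y e] z mem_level_iff[OF assms(1), of x y h] assms
    by (auto simp: abs_le_iff)
qed

lemma FX_mono:
  assumes "0 < \<epsilon>" "x \<in> S" "0 \<le> y" "y < x"
  shows "FX \<epsilon> y < FX \<epsilon> x"
  using potential_well.F_less[OF X.well[OF assms(1)] assms(2-4)] by (simp add: FX_eq assms(1))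

lemma FX_ge_F0: "0 \<le> \<epsilon> \<Longrightarrow> x \<in> S \<Longrightarrow> X.F0 x \<le> FX \<epsilon> x"
  using X.F1_nonneg[of x] by (simp add: FX_def)

lemma joint_cont:
  "continuous_on A (\<lambda>z. FX (fst z) (fst (snd z)))"
  "continuous_on A (\<lambda>z. GY (fst z) (snd (snd z)))"
  unfolding FX_def GY_def X.F0_def X.F1_def Y.F0_def Y.F1_def by (intro continuous_intros)+

text \<open>For \<open>0 \<le> \<epsilon> \<le> 1\<close> the points \<open>(\<epsilon>, x, y)\<close> with \<open>(x, y)\<close> on the oval of energy \<open>e\<close> form a compact set. The
  speed is positive on it: for \<open>\<epsilon> > 0\<close> the only equilibrium with \<open>x \<le> m + 1\<close> is the origin, whose energy
  is \<open>0\<close>, and for \<open>\<epsilon> = 0\<close> the equilibria are the grid points, whose energies are excluded. So the speed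
  has a positive minimum, which bounds the periods.\<close>

lemma period_bounded_at_regular_energy:
  assumes e: "0 < e" "e < X.F0 (real m + 1)"
    and reg: "\<And>i j. i \<le> m \<Longrightarrow> j \<le> m \<Longrightarrow> e \<noteq> E 0 (i, j)"
  obtains C where "\<And>\<epsilon> h. 0 < \<epsilon> \<Longrightarrow> \<epsilon> \<le> 1 \<Longrightarrow> h \<in> J \<Longrightarrow> FX \<epsilon> h = e \<Longrightarrow> T \<epsilon> h \<le> C"
proof -
  define Z where "Z = {z \<in> {0..1} \<times> ({- R e..real m + 1} \<times> {- R e..R e}).
      FX (fst z) (fst (snd z)) + GY (fst z) (snd (snd z)) = e}"
  define k where "k z = \<bar>fst (snd z) * poly (X.p (fst z)) (fst (snd z))\<bar> +
                        \<bar>snd (snd z) * poly (q (fst z)) (snd (snd z))\<bar>" for z :: "real \<times> real \<times> real"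
  have Z_eq: "Z = ({0..1} \<times> ({- R e..real m + 1} \<times> {- R e..R e})) \<inter>
      {z. FX (fst z) (fst (snd z)) + GY (fst z) (snd (snd z)) = e}"
    by (auto simp: Z_def)
  have "compact Z"
    unfolding Z_eq
    by (intro compact_Int_closed compact_Times compact_Icc closed_Collect_eq
        continuous_on_add joint_cont continuous_on_const)
  have kcont: "continuous_on Z k"
    unfolding k_def X.p_def q_def Y.p_def by (simp, intro continuous_intros)
  have kpos: "0 < k z" if z: "z \<in> Z" for z
  proof -
    obtain \<epsilon> x y where zz: "z = (\<epsilon>, x, y)" by (cases z)
    have \<epsilon>: "0 \<le> \<epsilon>" "\<epsilon> \<le> 1" and x: "x \<in> S" and E: "FX \<epsilon> x + GY \<epsilon> y = e"
      using z X.S_props(3)[of x] by (auto simp: Z_def zz)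
    have "\<not> (x * poly (X.p \<epsilon>) x = 0 \<and> y * poly (q \<epsilon>) y = 0)"
    proof
      assume a: "x * poly (X.p \<epsilon>) x = 0 \<and> y * poly (q \<epsilon>) y = 0"
      then have x0: "x = 0 \<or> \<epsilon> = 0 \<and> (\<exists>i\<in>{1..m}. x = real i)"
        using X.p_zero_iff[OF \<epsilon>(1) x] by blast
      have "y * poly (Y.p \<epsilon>) y = 0" using a \<kappa>_pos by (auto simp: q_def)
      then have y0: "y = 0 \<or> \<epsilon> = 0 \<and> (\<exists>j\<in>{1..m}. y = real j)"
        using Y.p_zero_iff[OF \<epsilon>(1) UNIV_I] by blast
      have "x = 0 \<and> y = 0 \<or> \<epsilon> = 0 \<and> (\<exists>i\<le>m. x = real i) \<and> (\<exists>j\<le>m. y = real j)"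
        using x0 y0 by (metis atLeastAtMost_iff le0 of_nat_0)
      then show False
      proof
        assume "x = 0 \<and> y = 0"
        then show False using E e by (simp add: FX_def GY_def)
      next
        assume "\<epsilon> = 0 \<and> (\<exists>i\<le>m. x = real i) \<and> (\<exists>j\<le>m. y = real j)"
        then show False using E reg unfolding E_def by auto
      qed
    qed
    then show ?thesis by (auto simp: k_def zz add_pos_nonneg add_nonneg_pos)
  qed
  obtain \<delta> where \<delta>: "0 < \<delta>" "\<And>z. z \<in> Z \<Longrightarrow> \<delta> \<le> k z"
  proof (cases "Z = {}")
    case False
    then obtain z0 where "z0 \<in> Z" "\<And>z. z \<in> Z \<Longrightarrow> k z0 \<le> k z"
      using continuous_attains_inf[OF \<open>compact Z\<close> _ kcont] by blast
    then show ?thesis using that[of "k z0"] kpos by blast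
  qed (use that[of 1] in auto)
  show ?thesis
  proof (rule that[of "16 * R e / \<delta>"])
    fix \<epsilon> h assume \<epsilon>: "0 < \<epsilon>" "\<epsilon> \<le> 1" and h: "h \<in> J" "FX \<epsilon> h = e"
    interpret C: separable_center S "X.p \<epsilon>" "X.K \<epsilon>" "q \<epsilon>" "L \<epsilon>" by (rule separable[OF \<epsilon>(1)])
    have "\<delta> * C.period h \<le> 16 * R e"
    proof (rule C.period_upper_bound)
      show "h \<in> C.I" using h J_eq[OF \<epsilon>(1)] by simp
      show box: "C.level h \<subseteq> {- R e..R e} \<times> {- R e..R e}" using \<epsilon> h by (intro level_box) auto
      fix x y assume xy: "(x, y) \<in> C.level h"
      then have l: "x \<in> S" "FX \<epsilon> x + GY \<epsilon> y = e" using mem_level_iff[OF \<epsilon>(1)] h by auto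
      \<comment> \<open>Beyond \<open>m + 1\<close> the potential alone exceeds \<open>e\<close>.\<close>
      have "x \<le> real m + 1"
      proof (rule ccontr)
        assume "\<not> x \<le> real m + 1"
        then have "FX \<epsilon> (real m + 1) < FX \<epsilon> x" by (intro FX_mono \<epsilon> l) auto
        moreover have "X.F0 (real m + 1) \<le> FX \<epsilon> (real m + 1)"
          using \<epsilon> by (intro FX_ge_F0 X.S_props) auto
        ultimately show False using l(2) e GY_bounds(1)[of \<epsilon> y] \<epsilon> by linarith
      qed
      then have "(\<epsilon>, x, y) \<in> Z" using xy box l \<epsilon> by (auto simp: Z_def)
      from \<delta>(2)[OF this] show "\<delta> \<le> \<bar>poly C.X.f x\<bar> + \<bar>poly C.Y.f y\<bar>"
        by (simp add: k_def fX_eq[OF \<epsilon>(1)] gY_eq[OF \<epsilon>(1)])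
    qed
    then show "T \<epsilon> h \<le> 16 * R e / \<delta>"
      using \<delta>(1) by (simp add: T_def pos_le_divide_eq mult.commute)
  qed
qed

lemma X_p_linear: "pCons 0 (X.p \<epsilon>) = pCons 0 (X.p 0) + smult \<epsilon> (pCons 0 w)"
  by (simp add: X.p_def algebra_simps)

lemma q_linear: "pCons 0 (q \<epsilon>) = pCons 0 (q 0) + smult \<epsilon> (pCons 0 [:\<kappa>:])"
  by (simp add: q_def Y.p_def smult_add_right mult.commute)

lemma E_mono: "i \<le> m \<Longrightarrow> 0 \<le> \<epsilon> \<Longrightarrow> \<epsilon> \<le> 1 \<Longrightarrow> E \<epsilon> (i, j) \<le> E 1 (i, j)"
  using X.F1_nonneg[of "real i"] Y.F1_nonneg[of "real j"] X.S_props(3)[of "real i"] \<kappa>_pos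
  by (auto simp: E_def FX_def GY_def intro!: add_mono mult_left_mono mult_left_le_one_le)

text \<open>At \<open>(i, j)\<close> the square of the speed is a constant times \<open>\<epsilon>\<^sup>2\<close>, while the Lipschitz constants are uniform
  in \<open>\<epsilon>\<close>. Periods bounded by \<open>M\<close> would contradict \<open>period_lower_bound\<close>.\<close>

lemma period_unbounded_at_tooth:
  assumes ij: "i \<le> m" "j \<le> m" "(i, j) \<noteq> (0, 0)"
  shows "\<forall>\<^sub>F \<epsilon> in at_right 0. \<forall>h\<in>J. FX \<epsilon> h = E \<epsilon> (i, j) \<longrightarrow> M < T \<epsilon> h"
proof -
  define r where "r = R (E 1 (i, j))"
  obtain \<Lambda>1 where \<Lambda>1: "0 \<le> \<Lambda>1" "\<And>\<epsilon> x y. 0 \<le> \<epsilon> \<Longrightarrow> \<epsilon> \<le> 1 \<Longrightarrow> \<bar>x\<bar> \<le> r \<Longrightarrow> \<bar>y\<bar> \<le> r \<Longrightarrow>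
      \<bar>poly (pCons 0 (X.p \<epsilon>)) x - poly (pCons 0 (X.p \<epsilon>)) y\<bar> \<le> \<Lambda>1 * \<bar>x - y\<bar>"
    using lipschitz_linear_family[of r "pCons 0 (X.p 0)" "pCons 0 w"]
    unfolding X_p_linear[symmetric] by metis
  obtain \<Lambda>2 where \<Lambda>2: "0 \<le> \<Lambda>2" "\<And>\<epsilon> x y. 0 \<le> \<epsilon> \<Longrightarrow> \<epsilon> \<le> 1 \<Longrightarrow> \<bar>x\<bar> \<le> r \<Longrightarrow> \<bar>y\<bar> \<le> r \<Longrightarrow>
      \<bar>poly (pCons 0 (q \<epsilon>)) x - poly (pCons 0 (q \<epsilon>)) y\<bar> \<le> \<Lambda>2 * \<bar>x - y\<bar>"
    using lipschitz_linear_family[of r "pCons 0 (q 0)" "pCons 0 [:\<kappa>:]"]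
    unfolding q_linear[symmetric] by metis
  define \<Lambda> where "\<Lambda> = \<Lambda>1 + \<Lambda>2"
  define D where "D = ((real i * poly w (real i))\<^sup>2 + (\<kappa> * real j)\<^sup>2) * exp ((2 * \<Lambda> + 1) * M)"
  have "((\<lambda>\<epsilon>. \<epsilon>\<^sup>2 * D) \<longlongrightarrow> 0) (at_right 0)" by (auto intro!: tendsto_eq_intros)
  then have "\<forall>\<^sub>F \<epsilon> in at_right 0. \<epsilon>\<^sup>2 * D < 1" by (rule order_tendstoD) simp
  moreover have "\<forall>\<^sub>F \<epsilon> in at_right (0::real). 0 < \<epsilon> \<and> \<epsilon> \<le> 1"
    by (rule eventually_at_rightI[of 0 1]) auto
  ultimately show ?thesis
  proof eventually_elim
    case (elim \<epsilon>)
    then have \<epsilon>: "0 < \<epsilon>" "\<epsilon> \<le> 1" and small: "\<epsilon>\<^sup>2 * D < 1" by auto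
    interpret C: separable_center S "X.p \<epsilon>" "X.K \<epsilon>" "q \<epsilon>" "L \<epsilon>" by (rule separable[OF \<epsilon>(1)])
    show ?case
    proof (intro ballI impI, rule ccontr)
      fix h assume h: "h \<in> J" "FX \<epsilon> h = E \<epsilon> (i, j)" "\<not> M < T \<epsilon> h"
      have "1 \<le> ((poly C.X.f (real i))\<^sup>2 + (poly C.Y.f (real j))\<^sup>2) * exp ((2 * \<Lambda> + 1) * C.period h)"
      proof (rule C.period_lower_bound)
        show "h \<in> C.I" using h J_eq[OF \<epsilon>(1)] by simp
        show "(real i, real j) \<in> C.level h"
          using h(2) ij X.S_props(3)[of "real i"] by (simp add: mem_level_iff[OF \<epsilon>(1)] E_def)
        show "1 \<le> real i \<or> 1 \<le> real j" using ij by auto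
        show "C.level h \<subseteq> {- r..r} \<times> {- r..r}"
          unfolding r_def using E_mono[of i \<epsilon> j] \<epsilon> ij h by (intro level_box) auto
        show "0 \<le> \<Lambda>" using \<Lambda>1 \<Lambda>2 by (simp add: \<Lambda>_def)
        fix x y :: real assume xy: "\<bar>x\<bar> \<le> r" "\<bar>y\<bar> \<le> r"
        have "\<Lambda>1 * \<bar>x - y\<bar> \<le> \<Lambda> * \<bar>x - y\<bar>" "\<Lambda>2 * \<bar>x - y\<bar> \<le> \<Lambda> * \<bar>x - y\<bar>"
          using \<Lambda>1(1) \<Lambda>2(1) by (auto simp: \<Lambda>_def intro!: mult_right_mono)
        then show "\<bar>poly C.X.f x - poly C.X.f y\<bar> \<le> \<Lambda> * \<bar>x - y\<bar>"
          "\<bar>poly C.Y.f x - poly C.Y.f y\<bar> \<le> \<Lambda> * \<bar>x - y\<bar>"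
          unfolding fX_eq[OF \<epsilon>(1)] gY_eq[OF \<epsilon>(1)]
          using \<Lambda>1(2)[of \<epsilon>, OF _ _ xy] \<Lambda>2(2)[of \<epsilon>, OF _ _ xy] \<epsilon> by linarith+
      qed
      also have "poly C.X.f (real i) = \<epsilon> * (real i * poly w (real i))"
        unfolding fX_eq[OF \<epsilon>(1)] using X.p_at_tooth[OF ij(1)] by simp
      also have "poly C.Y.f (real j) = \<epsilon> * (\<kappa> * real j)"
        unfolding gY_eq[OF \<epsilon>(1)] using Y.p_at_tooth[OF ij(2)] by (simp add: q_def algebra_simps)
      also have "((\<epsilon> * (real i * poly w (real i)))\<^sup>2 + (\<epsilon> * (\<kappa> * real j))\<^sup>2) * exp ((2 * \<Lambda> + 1) * C.period h)
          \<le> ((\<epsilon> * (real i * poly w (real i)))\<^sup>2 + (\<epsilon> * (\<kappa> * real j))\<^sup>2) * exp ((2 * \<Lambda> + 1) * M)"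
        using h(3) \<Lambda>1 \<Lambda>2 by (intro mult_left_mono) (auto simp: T_def \<Lambda>_def intro!: mult_left_mono)
      also have "\<dots> = \<epsilon>\<^sup>2 * D" by (simp add: D_def power_mult_distrib algebra_simps)
      finally show False using small by simp
    qed
  qed
qed

text \<open>The starting point \<open>(h, 0)\<close> approaches the equilibrium \<open>(m + 2, 0)\<close>, where the field vanishes; here
  \<open>\<epsilon>\<close> is fixed.\<close>

lemma period_unbounded_at_saddle:
  assumes S: "S \<noteq> UNIV" and \<epsilon>: "0 < \<epsilon>"
  obtains h where "h \<in> J" "real m + 1 < h" "M < T \<epsilon> h"
proof -
  interpret C: separable_center S "X.p \<epsilon>" "X.K \<epsilon>" "q \<epsilon>" "L \<epsilon>" by (rule separable[OF \<epsilon>])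
  define c where "c = real m + 2"
  have Sc: "S = {..<c}" and w: "w = [:c, - 1:]" using X.S_w S by (auto simp: c_def)
  have pc: "poly (X.p \<epsilon>) x \<le> 0" if "c \<le> x" for x
  proof -
    have "poly w x \<le> 0" using that by (simp add: w)
    then show ?thesis unfolding X.p_def using \<epsilon> square_comb_nonneg[of m x]
      by (simp add: mult_nonpos_nonneg)
  qed
  define r where "r = R (FX \<epsilon> c)"
  obtain \<Lambda>1 where \<Lambda>1: "0 \<le> \<Lambda>1" "\<And>x y. \<bar>x\<bar> \<le> r \<Longrightarrow> \<bar>y\<bar> \<le> r \<Longrightarrow>
      \<bar>poly C.X.f x - poly C.X.f y\<bar> \<le> \<Lambda>1 * \<bar>x - y\<bar>"
    using poly_lipschitz_on_bounded by blast
  obtain \<Lambda>2 where \<Lambda>2: "0 \<le> \<Lambda>2" "\<And>x y. \<bar>x\<bar> \<le> r \<Longrightarrow> \<bar>y\<bar> \<le> r \<Longrightarrow>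
      \<bar>poly C.Y.f x - poly C.Y.f y\<bar> \<le> \<Lambda>2 * \<bar>x - y\<bar>"
    using poly_lipschitz_on_bounded by blast
  define \<Lambda> where "\<Lambda> = \<Lambda>1 + \<Lambda>2"
  have "poly w c = 0" by (simp add: w)
  then have "poly C.X.f c = 0" unfolding fX_eq[OF \<epsilon>] by (simp add: X.p_def)
  then have "((\<lambda>h. (poly C.X.f h)\<^sup>2 * exp ((2 * \<Lambda> + 1) * M)) \<longlongrightarrow> 0) (at_left c)"
    by (auto intro!: tendsto_eq_intros)
  then have "\<forall>\<^sub>F h in at_left c. (poly C.X.f h)\<^sup>2 * exp ((2 * \<Lambda> + 1) * M) < 1"
    by (rule order_tendstoD) simp
  moreover have "\<forall>\<^sub>F h in at_left c. real m + 1 < h \<and> h < c"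
    by (rule eventually_at_leftI[of "real m + 1"]) (auto simp: c_def)
  ultimately have "\<forall>\<^sub>F h in at_left c. (poly C.X.f h)\<^sup>2 * exp ((2 * \<Lambda> + 1) * M) < 1 \<and> real m + 1 < h \<and> h < c"
    by eventually_elim simp
  then obtain h where small: "(poly C.X.f h)\<^sup>2 * exp ((2 * \<Lambda> + 1) * M) < 1"
    and h: "real m + 1 < h" "h < c"
    using eventually_happens[of _ "at_left c"] by (auto simp: trivial_limit_at_left_real)
  have "h \<in> S" unfolding Sc using h by simp
  then have hJ: "h \<in> J" using h by (simp add: J_def)
  have "M < T \<epsilon> h"
  proof (rule ccontr)
    assume notless: "\<not> M < T \<epsilon> h"
    have "1 \<le> ((poly C.X.f h)\<^sup>2 + (poly C.Y.f 0)\<^sup>2) * exp ((2 * \<Lambda> + 1) * C.period h)"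
    proof (rule C.period_lower_bound)
      show "h \<in> C.I" using hJ J_eq[OF \<epsilon>] by simp
      show "(h, 0) \<in> C.level h" using hJ by (simp add: mem_level_iff[OF \<epsilon>] J_def GY_def)
      show "1 \<le> h \<or> 1 \<le> (0::real)" using h by auto
      have "FX \<epsilon> h \<le> FX \<epsilon> c"
        using C.F_le_F_boundary(1)[OF Sc _ pc, of h] h by (simp add: FX_eq[OF \<epsilon>] c_def)
      then show "C.level h \<subseteq> {- r..r} \<times> {- r..r}" unfolding r_def by (intro level_box \<epsilon>)
      show "0 \<le> \<Lambda>" using \<Lambda>1 \<Lambda>2 by (simp add: \<Lambda>_def)
      fix x y :: real assume xy: "\<bar>x\<bar> \<le> r" "\<bar>y\<bar> \<le> r"
      have "\<Lambda>1 * \<bar>x - y\<bar> \<le> \<Lambda> * \<bar>x - y\<bar>" "\<Lambda>2 * \<bar>x - y\<bar> \<le> \<Lambda> * \<bar>x - y\<bar>"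
        using \<Lambda>1(1) \<Lambda>2(1) by (auto simp: \<Lambda>_def intro!: mult_right_mono)
      then show "\<bar>poly C.X.f x - poly C.X.f y\<bar> \<le> \<Lambda> * \<bar>x - y\<bar>"
          "\<bar>poly C.Y.f x - poly C.Y.f y\<bar> \<le> \<Lambda> * \<bar>x - y\<bar>"
        using \<Lambda>1(2)[OF xy] \<Lambda>2(2)[OF xy] by linarith+
    qed
    also have "poly C.Y.f 0 = 0" unfolding gY_eq[OF \<epsilon>] by simp
    also have "((poly C.X.f h)\<^sup>2 + 0\<^sup>2) * exp ((2 * \<Lambda> + 1) * C.period h)
        \<le> ((poly C.X.f h)\<^sup>2 + 0\<^sup>2) * exp ((2 * \<Lambda> + 1) * M)"
      using notless \<Lambda>1 \<Lambda>2 by (intro mult_left_mono) (auto simp: T_def \<Lambda>_def intro!: mult_left_mono)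
    finally show False using small by simp
  qed
  then show ?thesis using that hJ h(1) by blast
qed

text \<open>The energies of the grid points for \<open>\<epsilon> = 0\<close>, including \<open>0\<close> for the center, and the upper limit
  \<open>F0 (m + 1)\<close> are sorted into \<open>t 0 < \<dots> < t (k + 1)\<close>. The midpoints \<open>v i\<close> of neighbours are regular
  energies, with periods bounded independently of \<open>\<epsilon>\<close>. For small \<open>\<epsilon>\<close> the grid point \<open>\<pi> i\<close> still has its
  energy between \<open>v (i - 1)\<close> and \<open>v i\<close>, and a period above that bound.\<close>

lemma many_critical_parameters:
  assumes inj: "inj_on (E 0) ({..m} \<times> {..m})"
    and less: "\<And>i j. i \<le> m \<Longrightarrow> j \<le> m \<Longrightarrow> E 0 (i, j) < X.F0 (real m + 1)"
    and N: "N = 2 * ((m + 1)\<^sup>2 - 1) + (if S = UNIV then 0 else 1)"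
  obtains \<epsilon> where "0 < \<epsilon>"
    "infinite (critical_parameters (T \<epsilon>) J) \<or> N - 1 \<le> card (critical_parameters (T \<epsilon>) J)"
proof -
  define k where "k = (m + 1)\<^sup>2 - 1"
  define A where "A = {..m} \<times> {..m}"
  define \<Sigma> where "\<Sigma> = insert (X.F0 (real m + 1)) (E 0 ` A)"
  have "card (E 0 ` A) = (m + 1)\<^sup>2"
    using card_image[OF inj] by (simp add: A_def power2_eq_square)
  moreover have "X.F0 (real m + 1) \<notin> E 0 ` A" using less by (fastforce simp: A_def)
  ultimately have card: "card \<Sigma> = k + 2" by (simp add: \<Sigma>_def k_def A_def)
  have fin: "finite \<Sigma>" by (simp add: \<Sigma>_def A_def)
  obtain t where t: "t ` {..<k + 2} = \<Sigma>" "\<And>i j. i < j \<Longrightarrow> j < k + 2 \<Longrightarrow> t i < t j"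
    using sorted_enumeration[OF fin] card by metis
  have t_le: "t i \<le> t j" if "i \<le> j" "j < k + 2" for i j
    using t(2)[of i j] that by (cases "i = j") auto
  have E_nonneg: "0 \<le> E 0 ij" if "ij \<in> A" for ij
    using that FX_bounds(1)[of 0 "real (fst ij)"] GY_bounds(1)[of 0 "real (snd ij)"]
      X.S_props(3)[of "real (fst ij)"] by (auto simp: E_def A_def)
  have E_00: "E 0 (0, 0) = 0" by (simp add: E_def FX_def GY_def)
  have A_00: "(0, 0) \<in> A" by (simp add: A_def)
  have F_pos: "0 < X.F0 (real m + 1)" using less[of 0 0] E_00 by simp
  have t0: "t 0 = 0"
  proof (rule antisym)
    have "0 \<in> \<Sigma>" using E_00 A_00 by (force simp: \<Sigma>_def)
    then obtain a where "a < k + 2" "t a = 0" unfolding t(1)[symmetric] by auto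
    then show "t 0 \<le> 0" using t_le[of 0 a] by simp
    have "t 0 \<in> \<Sigma>" unfolding t(1)[symmetric] by simp
    then show "0 \<le> t 0" using E_nonneg F_pos by (auto simp: \<Sigma>_def)
  qed
  have tk: "t (k + 1) = X.F0 (real m + 1)"
  proof (rule antisym)
    have "X.F0 (real m + 1) \<in> \<Sigma>" by (simp add: \<Sigma>_def)
    then obtain a where "a < k + 2" "t a = X.F0 (real m + 1)" unfolding t(1)[symmetric] by auto
    then show "X.F0 (real m + 1) \<le> t (k + 1)" using t_le[of a "k + 1"] by simp
    have "t (k + 1) \<in> \<Sigma>" unfolding t(1)[symmetric] by simp
    then show "t (k + 1) \<le> X.F0 (real m + 1)" using less by (auto simp: \<Sigma>_def A_def less_imp_le)
  qed
  have "\<exists>ij. ij \<in> A \<and> E 0 ij = t i" if "1 \<le> i" "i \<le> k" for i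
  proof -
    have "t i \<in> \<Sigma>" using that unfolding t(1)[symmetric] by simp
    moreover have "t i < t (k + 1)" using that by (intro t(2)) auto
    ultimately show ?thesis unfolding \<Sigma>_def tk by (metis imageE insertE less_irrefl)
  qed
  then obtain \<pi> where \<pi>: "\<And>i. 1 \<le> i \<Longrightarrow> i \<le> k \<Longrightarrow> \<pi> i \<in> A" "\<And>i. 1 \<le> i \<Longrightarrow> i \<le> k \<Longrightarrow> E 0 (\<pi> i) = t i"
    by metis
  define v where "v i = (t i + t (i + 1)) / 2" for i
  have v: "t i < v i" "v i < t (i + 1)" if "i \<le> k" for i
    using t(2)[of i "i + 1"] that by (auto simp: v_def)
  have v_range: "0 < v i" "v i < X.F0 (real m + 1)" if "i \<le> k" for i
    using v[OF that] t_le[of 0 i] t_le[of "i + 1" "k + 1"] that t0 tk by auto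
  have v_regular: "v i \<noteq> E 0 (a, b)" if "i \<le> k" "a \<le> m" "b \<le> m" for i a b
  proof
    assume eq: "v i = E 0 (a, b)"
    have "E 0 (a, b) \<in> \<Sigma>" using that by (auto simp: \<Sigma>_def A_def)
    then obtain l where l: "l < k + 2" "t l = v i" unfolding eq t(1)[symmetric] by force
    show False
    proof (cases "l \<le> i")
      case True
      then show False using t_le[of l i] v(1)[OF that(1)] l that(1) by simp
    next
      case False
      then show False using t_le[of "i + 1" l] v(2)[OF that(1)] l by simp
    qed
  qed
  have "\<exists>C. \<forall>\<epsilon> h. 0 < \<epsilon> \<longrightarrow> \<epsilon> \<le> 1 \<longrightarrow> h \<in> J \<longrightarrow> FX \<epsilon> h = v i \<longrightarrow> T \<epsilon> h \<le> C" if "i \<le> k" for i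
    using period_bounded_at_regular_energy[of "v i"] v_range[OF that] v_regular[OF that] by metis
  then obtain C where C: "\<And>i \<epsilon> h. i \<le> k \<Longrightarrow> 0 < \<epsilon> \<Longrightarrow> \<epsilon> \<le> 1 \<Longrightarrow> h \<in> J \<Longrightarrow> FX \<epsilon> h = v i \<Longrightarrow> T \<epsilon> h \<le> C i"
    by metis
  define M where "M = (\<Sum>i\<le>k. \<bar>C i\<bar>) + 1"
  have CM: "C i < M" if "i \<le> k" for i
    using member_le_sum[of i "{..k}" "\<lambda>i. \<bar>C i\<bar>"] that by (simp add: M_def)
  have tends: "((\<lambda>\<epsilon>. E \<epsilon> ij) \<longlongrightarrow> E 0 ij) (at_right 0)" for ij
    unfolding E_def FX_def GY_def by (auto intro!: tendsto_eq_intros)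
  have "\<forall>\<^sub>F \<epsilon> in at_right 0. \<forall>i\<in>{1..k}. (\<forall>h\<in>J. FX \<epsilon> h = E \<epsilon> (\<pi> i) \<longrightarrow> M < T \<epsilon> h) \<and>
      v (i - 1) < E \<epsilon> (\<pi> i) \<and> E \<epsilon> (\<pi> i) < v i"
  proof (rule eventually_ball_finite[OF finite_atLeastAtMost], rule ballI)
    fix i assume "i \<in> {1..k}"
    then have i: "1 \<le> i" "i \<le> k" by auto
    obtain a b where ab: "\<pi> i = (a, b)" by (cases "\<pi> i")
    have "E 0 (a, b) \<noteq> 0" using t(2)[of 0 i] i t0 \<pi>(2)[OF i] ab by simp
    then have "(a, b) \<noteq> (0, 0)" using E_00 by metis
    moreover have "a \<le> m" "b \<le> m" using \<pi>(1)[OF i] ab by (auto simp: A_def)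
    ultimately have 1: "\<forall>\<^sub>F \<epsilon> in at_right 0. \<forall>h\<in>J. FX \<epsilon> h = E \<epsilon> (\<pi> i) \<longrightarrow> M < T \<epsilon> h"
      unfolding ab by (intro period_unbounded_at_tooth)
    have 2: "\<forall>\<^sub>F \<epsilon> in at_right 0. v (i - 1) < E \<epsilon> (\<pi> i)"
      using v(2)[of "i - 1"] i \<pi>(2)[OF i] by (intro order_tendstoD(1)[OF tends]) auto
    have 3: "\<forall>\<^sub>F \<epsilon> in at_right 0. E \<epsilon> (\<pi> i) < v i"
      using v(1)[of i] i \<pi>(2)[OF i] by (intro order_tendstoD(2)[OF tends]) auto
    show "\<forall>\<^sub>F \<epsilon> in at_right 0. (\<forall>h\<in>J. FX \<epsilon> h = E \<epsilon> (\<pi> i) \<longrightarrow> M < T \<epsilon> h) \<and>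
        v (i - 1) < E \<epsilon> (\<pi> i) \<and> E \<epsilon> (\<pi> i) < v i"
      using 1 2 3 by eventually_elim blast
  qed
  moreover have "\<forall>\<^sub>F \<epsilon> in at_right (0::real). 0 < \<epsilon> \<and> \<epsilon> \<le> 1"
    by (rule eventually_at_rightI[of 0 1]) auto
  ultimately obtain \<epsilon> where \<epsilon>: "0 < \<epsilon>" "\<epsilon> \<le> 1"
    and peak: "\<And>i h. i \<in> {1..k} \<Longrightarrow> h \<in> J \<Longrightarrow> FX \<epsilon> h = E \<epsilon> (\<pi> i) \<Longrightarrow> M < T \<epsilon> h"
    and between: "\<And>i. i \<in> {1..k} \<Longrightarrow> v (i - 1) < E \<epsilon> (\<pi> i)" "\<And>i. i \<in> {1..k} \<Longrightarrow> E \<epsilon> (\<pi> i) < v i"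
    using eventually_happens[OF eventually_conj, of _ "at_right 0"]
    by (smt (verit) trivial_limit_at_right_real)
  interpret C: separable_center S "X.p \<epsilon>" "X.K \<epsilon>" "q \<epsilon>" "L \<epsilon>" by (rule separable[OF \<epsilon>(1)])
  \<comment> \<open>The energies with alternately low and high periods, in increasing order.\<close>
  define a where "a n = (if even n then v (n div 2) else E \<epsilon> (\<pi> (n div 2 + 1)))" for n
  have a_less: "a n < a (Suc n)" if "n < 2 * k" for n
  proof (cases "even n")
    case True
    then obtain i where "n = 2 * i" by blast
    then show ?thesis using between(1)[of "i + 1"] that by (simp add: a_def)
  next
    case False
    then obtain i where "n = 2 * i + 1" by (blast elim: oddE)
    then show ?thesis using between(2)[of "i + 1"] that by (simp add: a_def)
  qed
  have a_range: "0 < a n \<and> a n < X.F0 (real m + 1)" if n: "n \<le> 2 * k" for n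
  proof (cases "even n")
    case True
    then show ?thesis using v_range[of "n div 2"] n by (auto simp: a_def)
  next
    case False
    then obtain i where i: "n = 2 * i + 1" by (blast elim: oddE)
    then show ?thesis using between[of "i + 1"] v_range[of i] v_range[of "i + 1"] n
      by (simp add: a_def)
  qed
  have m1: "real m + 1 \<in> J" using X.S_props(3)[of "real m + 1"] by (simp add: J_def)
  have "\<exists>h. h \<in> J \<and> h < real m + 1 \<and> FX \<epsilon> h = a n" if n: "n \<le> 2 * k" for n
  proof -
    have "X.F0 (real m + 1) \<le> FX \<epsilon> (real m + 1)" using \<epsilon> m1 by (intro FX_ge_F0) (auto simp: J_def)
    then have "a n < C.X.F (real m + 1)" using a_range[OF n] by (simp add: FX_eq[OF \<epsilon>(1)])
    then show ?thesis
      using C.F_intermediate[of "real m + 1" "a n"] a_range[OF n] m1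
      unfolding J_eq[OF \<epsilon>(1)] FX_eq[OF \<epsilon>(1)] by metis
  qed
  then obtain h where h: "\<And>n. n \<le> 2 * k \<Longrightarrow> h n \<in> J" "\<And>n. n \<le> 2 * k \<Longrightarrow> h n < real m + 1"
      "\<And>n. n \<le> 2 * k \<Longrightarrow> FX \<epsilon> (h n) = a n"
    by metis
  have h_less: "h n < h (Suc n)" if n: "n < 2 * k" for n
  proof (rule ccontr)
    assume "\<not> h n < h (Suc n)"
    then have "h (Suc n) = h n \<or> FX \<epsilon> (h (Suc n)) < FX \<epsilon> (h n)"
      using FX_mono[OF \<epsilon>(1), of "h n" "h (Suc n)"] h(1)[of n] h(1)[of "Suc n"] n by (force simp: J_def)
    then show False using a_less[OF n] h(3)[of n] h(3)[of "Suc n"] n by auto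
  qed
  have low: "T \<epsilon> (h n) < M" if n: "n \<le> 2 * k" "even n" for n
  proof -
    have "n div 2 \<le> k" using n(1) by simp
    then show ?thesis
      using C[of "n div 2" \<epsilon> "h n"] CM[of "n div 2"] h[OF n(1)] n(2) \<epsilon> by (simp add: a_def)
  qed
  have high: "M < T \<epsilon> (h n)" if n: "n \<le> 2 * k" "odd n" for n
  proof -
    obtain i where i: "n = 2 * i + 1" using n(2) by (blast elim: oddE)
    then show ?thesis using peak[of "i + 1" "h n"] h[OF n(1)] n by (simp add: a_def)
  qed
  have J: "is_interval J" and cont: "continuous_on J (T \<epsilon>)"
    using C.I_interval C.period_cont J_eq[OF \<epsilon>(1)] by (auto simp: T_def)
  show ?thesis
  proof (cases "S = UNIV")
    case True
    then have "N = 2 * k" using N by (simp add: k_def)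
    then show ?thesis
      using alternating_values_critical_parameters[OF J cont, of "2 * k" h M] h(1) h_less low high
      by (intro that[OF \<epsilon>(1)]) auto
  next
    case False
    then have N': "N = 2 * k + 1" using N by (simp add: k_def)
    obtain h' where h': "h' \<in> J" "real m + 1 < h'" "M < T \<epsilon> h'"
      using period_unbounded_at_saddle[OF False \<epsilon>(1)] by blast
    \<comment> \<open>One more high value, close to the equilibrium that bounds the annulus.\<close>
    define s where "s n = (if n \<le> 2 * k then h n else h')" for n
    have "infinite (critical_parameters (T \<epsilon>) J) \<or> 2 * k + 1 - 1 \<le> card (critical_parameters (T \<epsilon>) J)"
    proof (rule alternating_values_critical_parameters[OF J cont, of "2 * k + 1" s M])
      fix i assume i: "i < 2 * k + 1"
      show "s i < s (Suc i)"
      proof (cases "i < 2 * k")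
        case True
        then show ?thesis using h_less[of i] by (simp add: s_def)
      next
        case False
        then show ?thesis using i h(2)[of i] h'(2) by (simp add: s_def)
      qed
    next
      fix i assume i: "i \<le> 2 * k + 1"
      show "s i \<in> J" using h(1) h'(1) by (simp add: s_def)
      show "T \<epsilon> (s i) < M" if "even i"
      proof -
        have "i \<le> 2 * k" using i that by (cases "i = 2 * k + 1") auto
        then show ?thesis using low that by (simp add: s_def)
      qed
      show "M < T \<epsilon> (s i)" if "odd i" using high h'(3) that by (simp add: s_def)
    qed
    then show ?thesis using N' by (intro that[OF \<epsilon>(1)]) auto
  qed
qed

end

section \<open>Degrees, generic parameters and the conclusion\<close>

lemma poly_const_coeffs: "poly (map_poly (\<lambda>c. [:c:]) g) [:y:] = [:poly g (y :: real):]"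
  by (induction g) (simp_all add: map_poly_pCons)

lemma total_degree_y:
  assumes "g \<noteq> (0 :: real poly)"
  shows "total_degree (map_poly (\<lambda>c. [:c:]) g) = degree g"
proof -
  have ne: "map_poly (\<lambda>c. [:c:]) g \<noteq> 0"
    using assms by (simp add: map_poly_eq_0_iff)
  have c: "coeff (coeff (map_poly (\<lambda>c. [:c:]) g) j) i = (if i = 0 then coeff g j else 0)" for i j
    by (simp add: coeff_map_poly coeff_pCons split: nat.split)
  have "{i + j |i j. coeff (coeff (map_poly (\<lambda>c. [:c:]) g) j) i \<noteq> 0} = {j. coeff g j \<noteq> 0}"
    by (auto simp: c split: if_splits)
  moreover have "Max {j. coeff g j \<noteq> 0} = degree g"
    using assms by (intro Max_eqI) (auto intro: le_degree finite_subset[of _ "{..degree g}"])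
  ultimately show ?thesis using ne by (simp add: total_degree_def)
qed

lemma total_degree_x:
  assumes "f \<noteq> (0 :: real poly)"
  shows "total_degree [:f:] = degree f"
proof -
  have c: "coeff (coeff [:f:] j) i = (if j = 0 then coeff f i else 0)" for i j
    by (simp add: coeff_pCons split: nat.split)
  have "{i + j |i j. coeff (coeff [:f:] j) i \<noteq> 0} = {i. coeff f i \<noteq> 0}"
    by (auto simp: c split: if_splits)
  moreover have "Max {i. coeff f i \<noteq> 0} = degree f"
    using assms by (intro Max_eqI) (auto intro: le_degree finite_subset[of _ "{..degree f}"])
  ultimately show ?thesis using assms by (simp add: total_degree_def)
qed

lemma separable_field_polynomial:
  "vector_field (map_poly (\<lambda>c. [:c:]) (- g)) [:f:] = separable_field f g"
  unfolding vector_field_def separable_field_def eval2_def poly_const_coeffs by simp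

text \<open>If two grid points in different rows have the same energy, this determines \<open>\<kappa>\<close>; in the same row
  it is impossible. So only finitely many \<open>\<kappa>\<close> are bad, and a small one keeps all energies below
  \<open>F0 (m + 1)\<close>.\<close>

lemma exists_generic_comb_pair:
  fixes m :: nat
  assumes S_w: "S = UNIV \<and> w = 1 \<or> S = {..<real m + 2} \<and> w = [:real m + 2, - 1:]"
  obtains Kb Kw Lb Lw \<kappa> where "comb_pair m S w Kb Kw Lb Lw \<kappa>"
    "inj_on (comb_pair.E Kb Kw Lb Lw \<kappa> 0) ({..m} \<times> {..m})"
    "\<And>i j. i \<le> m \<Longrightarrow> j \<le> m \<Longrightarrow> comb_pair.E Kb Kw Lb Lw \<kappa> 0 (i, j) < comb.F0 Kb (real m + 1)"
proof -
  obtain Kb where Kb: "smult 2 Kb + pCons 0 (pderiv Kb) = w * square_comb m"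
    by (rule halving_equation_solvable)
  obtain Kw where Kw: "smult 2 Kw + pCons 0 (pderiv Kw) = w"
    by (rule halving_equation_solvable)
  obtain Lb where Lb: "smult 2 Lb + pCons 0 (pderiv Lb) = 1 * square_comb m"
    by (rule halving_equation_solvable)
  obtain Lw where Lw: "smult 2 Lw + pCons 0 (pderiv Lw) = (1 :: real poly)"
    by (rule halving_equation_solvable)
  interpret X: comb m S w Kb Kw using S_w Kb Kw by unfold_locales
  interpret Y: comb m UNIV 1 Lb Lw using Lb Lw by unfold_locales auto
  define gap where "gap = X.F0 (real m + 1) - X.F0 (real m)"
  have gap: "0 < gap" using X.F0_Suc[of m] by (simp add: gap_def add.commute)
  define Bad where "Bad = (\<lambda>(i, i', j, j'). (X.F0 (real i) - X.F0 (real i')) / (Y.F0 (real j') - Y.F0 (real j)))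
      ` ({..m} \<times> {..m} \<times> {..m} \<times> {..m})"
  have Ym: "0 \<le> Y.F0 (real m)" by (rule Y.F0_growth) simp
  define b where "b = gap / (Y.F0 (real m) + 1)"
  have b: "0 < b" using gap Ym by (simp add: b_def)
  have "infinite ({0<..<b} - Bad)"
    using b by (intro Diff_infinite_finite) (auto simp: Bad_def infinite_Ioo)
  then obtain \<kappa> where \<kappa>: "0 < \<kappa>" "\<kappa> < b" "\<kappa> \<notin> Bad"
    by (metis DiffD1 DiffD2 ex_in_conv finite.emptyI greaterThanLessThan_iff)
  interpret P: comb_pair m S w Kb Kw Lb Lw \<kappa> using \<kappa>(1) by unfold_locales
  have E: "P.E 0 (i, j) = X.F0 (real i) + \<kappa> * Y.F0 (real j)" for i j
    by (simp add: P.E_def P.FX_def P.GY_def)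
  have X_inj: "i = i'" if "X.F0 (real i) = X.F0 (real i')" "i \<le> m" "i' \<le> m" for i i'
    using X.F0_less[of i i'] X.F0_less[of i' i] that by (metis le_SucI less_irrefl linorder_neqE_nat)
  have Y_inj: "i = i'" if "Y.F0 (real i) = Y.F0 (real i')" "i \<le> m" "i' \<le> m" for i i'
    using Y.F0_less[of i i'] Y.F0_less[of i' i] that by (metis le_SucI less_irrefl linorder_neqE_nat)
  have "inj_on (P.E 0) ({..m} \<times> {..m})"
  proof (rule inj_onI, clarsimp)
    fix i j i' j' assume le: "i \<le> m" "j \<le> m" "i' \<le> m" "j' \<le> m" and eq: "P.E 0 (i, j) = P.E 0 (i', j')"
    have "j = j'"
    proof (rule ccontr)
      assume "j \<noteq> j'"
      then have "Y.F0 (real j') - Y.F0 (real j) \<noteq> 0" using Y_inj[of j j'] le by auto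
      moreover have "X.F0 (real i) - X.F0 (real i') = \<kappa> * (Y.F0 (real j') - Y.F0 (real j))"
        using eq by (simp add: E algebra_simps)
      ultimately have "\<kappa> = (X.F0 (real i) - X.F0 (real i')) / (Y.F0 (real j') - Y.F0 (real j))" by simp
      also have "\<dots> \<in> Bad"
        unfolding Bad_def by (rule image_eqI[of _ _ "(i, i', j, j')"]) (use le in auto)
      finally show False using \<kappa>(3) by simp
    qed
    then show "i = i' \<and> j = j'" using X_inj[of i i'] eq le by (simp add: E)
  qed
  moreover have "P.E 0 (i, j) < X.F0 (real m + 1)" if "i \<le> m" "j \<le> m" for i j
  proof -
    have "X.F0 (real i) \<le> X.F0 (real m)" "Y.F0 (real j) \<le> Y.F0 (real m)"
      using X.F0_less[of i m] Y.F0_less[of j m] that by (cases "i = m"; cases "j = m"; force)+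
    then have "P.E 0 (i, j) \<le> X.F0 (real m) + \<kappa> * Y.F0 (real m)"
      using \<kappa> unfolding E by (intro add_mono mult_left_mono) auto
    also have "\<kappa> * Y.F0 (real m) \<le> \<kappa> * (Y.F0 (real m) + 1)" using \<kappa> by simp
    also have "\<dots> < gap" using \<kappa>(2) Ym by (simp add: b_def pos_less_divide_eq)
    finally show ?thesis by (simp add: gap_def)
  qed
  ultimately show ?thesis using that P.comb_pair_axioms by blast
qed

theorem theorem1p2:
  fixes n :: nat
  assumes "n \<ge> 1"
  shows "\<exists>(P :: real poly poly) (Q :: real poly poly) (p :: real \<times> real) I \<sigma>.
    system_degree P Q = n \<and>
    is_center (vector_field P Q) p \<and>
    global_transversal_section (vector_field P Q) (period_annulus (vector_field P Q) p) I \<sigma> \<and>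
    ereal_of_enat (num_critical_periods (vector_field P Q) I \<sigma>) \<ge>
      ereal (if odd n then (real n)\<^sup>2 / 2 + real n - 5 / 2 else (real n)\<^sup>2 / 2 - 2)"
proof -
  define m where "m = (n - 1) div 2"
  define S where "S = (if odd n then UNIV else {..<real m + 2})"
  define w where "w = (if odd n then 1 else [:real m + 2, - 1:])"
  have n: "n = 2 * m + 1 + (if odd n then 0 else 1)"
    using assms by (auto simp: m_def elim!: oddE evenE)
  have S_UNIV: "S = UNIV \<longleftrightarrow> odd n" by (auto simp: S_def lessThan_eq_iff)
  have S_w: "S = UNIV \<and> w = 1 \<or> S = {..<real m + 2} \<and> w = [:real m + 2, - 1:]"
    by (auto simp: S_def w_def)
  obtain Kb Kw Lb Lw \<kappa> where pair: "comb_pair m S w Kb Kw Lb Lw \<kappa>"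
    and inj: "inj_on (comb_pair.E Kb Kw Lb Lw \<kappa> 0) ({..m} \<times> {..m})"
    and less: "\<And>i j. i \<le> m \<Longrightarrow> j \<le> m \<Longrightarrow> comb_pair.E Kb Kw Lb Lw \<kappa> 0 (i, j) < comb.F0 Kb (real m + 1)"
    by (rule exists_generic_comb_pair[OF S_w]) blast
  interpret P: comb_pair m S w Kb Kw Lb Lw \<kappa> by (fact pair)
  define N where "N = 2 * ((m + 1)\<^sup>2 - 1) + (if S = UNIV then 0 else 1)"
  obtain \<epsilon> where \<epsilon>: "0 < \<epsilon>"
    and N_le: "infinite (critical_parameters (P.T \<epsilon>) P.J) \<or> N - 1 \<le> card (critical_parameters (P.T \<epsilon>) P.J)"
    using P.many_critical_parameters[OF inj less N_def] by blast
  interpret C: separable_center S "P.X.p \<epsilon>" "P.X.K \<epsilon>" "P.q \<epsilon>" "P.L \<epsilon>" by (rule P.separable[OF \<epsilon>])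
  define PP where "PP = map_poly (\<lambda>c. [:c:]) (- C.Y.f)"
  define QQ where "QQ = [:C.X.f:]"
  have vf: "vector_field PP QQ = C.vf"
    by (simp add: PP_def QQ_def separable_field_polynomial C.vf_def)
  have q0: "P.q \<epsilon> \<noteq> 0" and dq: "degree C.Y.f = 2 * m + 1"
    using P.Y.p_nonzero[OF \<epsilon>] P.Y.degree_p[OF \<epsilon>] P.\<kappa>_pos
    unfolding P.gY_eq[OF \<epsilon>] by (simp_all add: P.q_def)
  have deg: "system_degree PP QQ = n"
  proof -
    have "total_degree PP = 2 * m + 1"
      unfolding PP_def by (subst total_degree_y) (use q0 dq P.gY_eq[OF \<epsilon>] in auto)
    moreover have "total_degree QQ = n"
      unfolding QQ_def P.fX_eq[OF \<epsilon>] using n S_UNIV P.X.p_nonzero[OF \<epsilon>] P.X.degree_p[OF \<epsilon>]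
      by (subst total_degree_x) (auto split: if_splits)
    ultimately show ?thesis using n by (auto simp: system_degree_def)
  qed
  have crit: "critical_parameters (period_function C.vf (\<lambda>h. (h, 0))) P.J = critical_parameters (P.T \<epsilon>) P.J"
    by (rule critical_parameters_cong)
      (simp add: C.period_function_eq P.J_eq[OF \<epsilon>] P.T_def)
  have bound: "(if odd n then (real n)\<^sup>2 / 2 + real n - 5 / 2 else (real n)\<^sup>2 / 2 - 2) \<le> real (N - 1)"
  proof -
    have N: "real N = 2 * ((real m + 1)\<^sup>2 - 1) + (if odd n then 0 else 1)"
      by (simp add: N_def S_UNIV of_nat_diff)
    have "real N - 1 \<le> real (N - 1)" by simp
    moreover have "(if odd n then (real n)\<^sup>2 / 2 + real n - 5 / 2 else (real n)\<^sup>2 / 2 - 2) = real N - 1"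
    proof (cases "odd n")
      case True
      then have "real n = 2 * real m + 1" using n by simp
      then show ?thesis using True by (simp add: N power2_eq_square field_simps)
    next
      case False
      then have "real n = 2 * real m + 2" using n by simp
      then show ?thesis using False by (simp add: N power2_eq_square field_simps)
    qed
    ultimately show ?thesis by simp
  qed
  have "ereal (if odd n then (real n)\<^sup>2 / 2 + real n - 5 / 2 else (real n)\<^sup>2 / 2 - 2)
      \<le> ereal_of_enat (num_critical_periods C.vf P.J (\<lambda>h. (h, 0)))"
  proof (cases "finite (critical_parameters (P.T \<epsilon>) P.J)")
    case True
    then have "real (N - 1) \<le> real (card (critical_parameters (P.T \<epsilon>) P.J))" using N_le by simp
    then show ?thesis using True bound by (simp add: num_critical_periods_def crit)
  qed (simp add: num_critical_periods_def crit)
  moreover have "global_transversal_section C.vf (period_annulus C.vf (0, 0)) P.J (\<lambda>h. (h, 0))"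
    using C.global_section by (simp add: P.J_eq[OF \<epsilon>])
  ultimately show ?thesis
    using deg C.center by (intro exI[of _ PP] exI[of _ QQ] exI[of _ "(0, 0)"] exI[of _ P.J] exI[of _ "\<lambda>h. (h, 0)"]) (simp only: vf simp_thms)
qed

end
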